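(* Let $\Pi\subset\mathbb{D}$ be an ideal polygon with counter-clockwise enumeration of sides $1,\dots,k$, and let $\mathbb{G}$ be the space of pointed geodesics on $\Pi$. Let $X$ be the space of all pointed bi-infinite sequences $\dots a_{-1}.a_0a_1\dots\in\{1,\dots,k\}^{\mathbb{Z}}$ satisfying the rules: (1) $a_j\neq a_{j+1}$ for all $j\in\mathbb{Z}$; and (2) $\dots a_{-1}.a_0a_1\dots$ does not contain an infinitely repeated sequence or bi-infinite sequence of labels of two adjacent sides. Then $(\mathbb{G},\tau)\simeq(X,\sigma)$.
   Context: $\mathbb{D}=\{z\in\mathbb{C}:|z|<1\}$ is the Poincaré disc model of the hyperbolic plane; $\partial\mathbb{D}$ is parameterized by the azimuthal angle and carries the natural metric $d_{\partial\mathbb{D}}(\phi_1,\phi_2)=|\phi_1-\phi_2|$. An ideal polygon is a $k$-sided hyperbolic polygon, $k\ge 3$, with all its vertices on $\partial\mathbb{D}$. A directed geodesic is represented by the pair $(\theta,\phi)$ of its intercepts with $\partial\mathbb{D}$, directed from $\theta$ to $\phi$. A billiard trajectory in $\Pi$ is a bi-infinite sequence $\gamma=(\theta_n,\phi_n)_{n\in\mathbb{Z}}$ of directed geodesics, consisting of the consecutive geodesic arcs in $\Pi$ between successive specular reflections at the sides of $\Pi$; the bounce map $T$ is given by $(\theta_n,\phi_n)=T(\theta_{n-1},\phi_{n-1})$. Trajectories starting or ending in vertices of $\Pi$ are not considered. Each $(\theta_n,\phi_n)$ is a base arc of $\gamma$ and determines $\gamma$. A pointed geodesic is a pair $(\gamma,(\theta,\phi))$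 where $(\theta,\phi)$ is a base arc defining $\gamma$; $\mathbb{G}=\{(\gamma,(\theta,\phi)):\gamma=(T^n(\theta,\phi))_{n\in\mathbb{Z}}\}$ with the metric $$d_{\mathbb{G}}\big((\gamma,(\theta,\phi)),(\gamma',(\theta',\phi'))\big)=\max\{d_{\partial\mathbb{D}}(\theta,\theta'),d_{\partial\mathbb{D}}(\phi,\phi')\},$$ and $\tau:\mathbb{G}\to\mathbb{G}$ is $\tau(\gamma,(\theta,\phi))=(\gamma,T(\theta,\phi))$. $X\subseteq\{1,\dots,k\}^{\mathbb{Z}}$ carries the metric $d(x,y)=\inf\{2^{-m}:x_n=y_n\text{ for }|n|<m\}$ (product topology), and $\sigma$ is the shift $(\sigma(x))_i=x_{i+1}$. Rule (2) means that the sequence is not of the form $\overline{ab}$ (bi-infinite alternation of $a,b$), and does not have a one-sided infinite (right or left) tail alternating between $a$ and $b$, for labels $a,b$ of any two adjacent sides (sides $k$ and $1$ are adjacent). The notation $\simeq$ means that the two systems are conjugate: there is a homeomorphism $h:\mathbb{G}\to X$ with $h\circ\tau=\sigma\circ h$. *)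

theory Defs
  imports "HOL-Complex_Analysis.Complex_Analysis"
begin

section \<open>Geodesics of the Poincare disc\<close>

text \<open>The Moebius map \<open>Moebius_function 0 p\<close> is the orientation preserving isometry of the disc that
  moves \<open>p\<close> to \<open>0\<close> and has positive derivative at \<open>p\<close>; its inverse is \<open>Moebius_function 0 (- p)\<close>.
  Geodesics through \<open>0\<close> are the diameters \<open>t \<mapsto> tanh (t/2) w\<close>. So \<open>geodesic p w\<close> is
  the unit speed geodesic which is at \<open>p\<close> at time \<open>0\<close>, with velocity
  \<open>((1 - \<bar>p\<bar>\<^sup>2) / 2) w\<close> there: the unit complex number \<open>w\<close> is its direction at \<open>p\<close>.\<close>

definition geodesic :: "complex \<Rightarrow> complex \<Rightarrow> real \<Rightarrow> complex" where
  "geodesic p w t = Moebius_function 0 (- p) (tanh (t / 2) *\<^sub>R w)"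

text \<open>Points of the boundary circle are unit complex numbers, the azimuthal angle \<open>\<phi>\<close> standing for
  \<open>cis \<phi>\<close>. A directed geodesic is given by the pair of its intercepts, (start, end).\<close>

type_synonym dirgeo = "complex \<times> complex"

definition passes :: "complex \<Rightarrow> complex \<Rightarrow> dirgeo \<Rightarrow> bool" where
  \<comment> \<open>the directed geodesic \<open>e\<close> passes through the point \<open>p\<close> of the disc in direction \<open>w\<close>\<close>
  "passes p w e \<longleftrightarrow> cmod p < 1 \<and> cmod w = 1 \<and>
     (geodesic p w \<longlongrightarrow> fst e) at_bot \<and> (geodesic p w \<longlongrightarrow> snd e) at_top"

text \<open>The distance \<open>\<bar>\<phi>\<^sub>1 - \<phi>\<^sub>2\<bar>\<close> of angles, taken modulo \<open>2 \<pi>\<close>: the length of the shorter arc.\<close>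

definition bd_dist :: "complex \<Rightarrow> complex \<Rightarrow> real" where
  "bd_dist z z' = \<bar>Arg (z / z')\<bar>"

section \<open>Ideal polygons\<close>

text \<open>The ideal vertices are \<open>v 1, \<dots>, v k\<close> in counter-clockwise order, and side \<open>j\<close> joins \<open>v j\<close> to
  the next vertex. Values of \<open>v\<close> outside \<open>{1..k}\<close> are irrelevant.\<close>

definition ideal_polygon_vertices :: "nat \<Rightarrow> (nat \<Rightarrow> complex) \<Rightarrow> bool" where
  "ideal_polygon_vertices k v \<longleftrightarrow> 3 \<le> k \<and>
     (\<exists>\<alpha> :: nat \<Rightarrow> real. strict_mono_on {1..k} \<alpha> \<and> \<alpha> k < \<alpha> 1 + 2 * pi \<and>
        (\<forall>j\<in>{1..k}. v j = cis (\<alpha> j)))"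

definition next_label :: "nat \<Rightarrow> nat \<Rightarrow> nat" where
  "next_label k j = (if j = k then 1 else j + 1)"

definition side :: "nat \<Rightarrow> (nat \<Rightarrow> complex) \<Rightarrow> nat \<Rightarrow> dirgeo" where
  "side k v j = (v j, v (next_label k j))"

text \<open>The closed half-plane on the left of a directed geodesic from \<open>a\<close> to \<open>b\<close>: after moving \<open>z\<close> to
  the origin, so that \<open>a\<close>, \<open>b\<close> become \<open>a'\<close>, \<open>b'\<close>, the counter-clockwise angle from
  \<open>a'\<close> to \<open>b'\<close> lies in \<open>(0, \<pi>]\<close>, that is \<open>sin\<close> of this angle is nonnegative.\<close>

definition left_halfplane :: "dirgeo \<Rightarrow> complex set" where
  "left_halfplane e = {z \<in> ball 0 1.
     0 \<le> Im (cnj (Moebius_function 0 z (fst e)) * Moebius_function 0 z (snd e))}"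

definition polygon :: "nat \<Rightarrow> (nat \<Rightarrow> complex) \<Rightarrow> complex set" where
  "polygon k v = (\<Inter>j\<in>{1..k}. left_halfplane (side k v j))"

section \<open>Billiards\<close>

text \<open>Reflection of the direction \<open>w\<close> in the line spanned by the unit complex number \<open>s\<close>. The disc
  model is conformal, so this is the law of specular reflection at a side whose direction is \<open>s\<close>.\<close>

definition reflect_dir :: "complex \<Rightarrow> complex \<Rightarrow> complex" where
  "reflect_dir s w = s\<^sup>2 * cnj w"

text \<open>The particle moves inside the polygon along \<open>e\<close> until it hits a side \<open>j\<close> at the point \<open>p\<close>, and
  leaves \<open>p\<close> into the polygon along \<open>e'\<close>. Directed geodesics are full geodesics of the disc; the arc
  travelled is the part inside the polygon.\<close>

definition bounce :: "nat \<Rightarrow> (nat \<Rightarrow> complex) \<Rightarrow> dirgeo \<Rightarrow> dirgeo \<Rightarrow> bool" where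
  "bounce k v e e' \<longleftrightarrow> (\<exists>j\<in>{1..k}. \<exists>p w s.
     passes p s (side k v j) \<and> passes p w e \<and> passes p (reflect_dir s w) e' \<and>
     (\<forall>\<^sub>F t in at_left 0. geodesic p w t \<in> polygon k v) \<and>
     (\<forall>\<^sub>F t in at_right 0. geodesic p (reflect_dir s w) t \<in> polygon k v))"

definition bounce_map :: "nat \<Rightarrow> (nat \<Rightarrow> complex) \<Rightarrow> dirgeo \<Rightarrow> dirgeo" where
  "bounce_map k v e = (THE e'. bounce k v e e')"

definition billiard_seq :: "nat \<Rightarrow> (nat \<Rightarrow> complex) \<Rightarrow> (int \<Rightarrow> dirgeo) \<Rightarrow> bool" where
  "billiard_seq k v g \<longleftrightarrow>
     (\<forall>n. bounce k v (g n) (g (n + 1)) \<and> fst (g n) \<notin> v ` {1..k} \<and> snd (g n) \<notin> v ` {1..k})"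

text \<open>The trajectory \<open>\<gamma>\<close> in a pointed geodesic \<open>(\<gamma>, (\<theta>, \<phi>))\<close> does not change when the base arc is
  moved along it, so it is a bi-infinite sequence up to the choice of the index \<open>0\<close>.\<close>

type_synonym trajectory = "(int \<Rightarrow> dirgeo) set"

definition trajectory_of :: "(int \<Rightarrow> dirgeo) \<Rightarrow> trajectory" where
  "trajectory_of g = range (\<lambda>m n. g (n + m))"

definition pointed_geodesics :: "nat \<Rightarrow> (nat \<Rightarrow> complex) \<Rightarrow> (trajectory \<times> dirgeo) set" where
  "pointed_geodesics k v = {(trajectory_of g, g 0) | g. billiard_seq k v g}"

definition geo_dist :: "trajectory \<times> dirgeo \<Rightarrow> trajectory \<times> dirgeo \<Rightarrow> real" where
  "geo_dist = (\<lambda>(_, \<theta>, \<phi>) (_, \<theta>', \<phi>'). max (bd_dist \<theta> \<theta>') (bd_dist \<phi> \<phi>'))"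

definition tau :: "nat \<Rightarrow> (nat \<Rightarrow> complex) \<Rightarrow> trajectory \<times> dirgeo \<Rightarrow> trajectory \<times> dirgeo" where
  "tau k v = (\<lambda>(\<gamma>, e). (\<gamma>, bounce_map k v e))"

section \<open>Symbolic sequences\<close>

definition adjacent :: "nat \<Rightarrow> nat \<Rightarrow> nat \<Rightarrow> bool" where
  "adjacent k a b \<longleftrightarrow> b = next_label k a \<or> a = next_label k b"

text \<open>As \<open>adjacent\<close> is symmetric, fixing the parity at which \<open>a\<close> occurs is harmless below.\<close>

definition alternates_on :: "int set \<Rightarrow> nat \<Rightarrow> nat \<Rightarrow> (int \<Rightarrow> nat) \<Rightarrow> bool" where
  "alternates_on I a b x \<longleftrightarrow> (\<forall>n\<in>I. x n = (if even n then a else b))"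

definition coding_space :: "nat \<Rightarrow> (int \<Rightarrow> nat) set" where
  "coding_space k = {x. (\<forall>j. x j \<in> {1..k}) \<and>
     (\<forall>j. x j \<noteq> x (j + 1)) \<and>
     (\<forall>a\<in>{1..k}. \<forall>b\<in>{1..k}. adjacent k a b \<longrightarrow>
        \<not> alternates_on UNIV a b x \<and>
        (\<forall>N. \<not> alternates_on {N..} a b x) \<and>
        (\<forall>N. \<not> alternates_on {..N} a b x))}"

definition seq_dist :: "(int \<Rightarrow> nat) \<Rightarrow> (int \<Rightarrow> nat) \<Rightarrow> real" where
  "seq_dist x y = Inf {1 / 2 ^ m | m :: nat. \<forall>n. \<bar>n\<bar> < int m \<longrightarrow> x n = y n}"

definition shift :: "(int \<Rightarrow> nat) \<Rightarrow> (int \<Rightarrow> nat)" where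
  "shift x = (\<lambda>i. x (i + 1))"

section \<open>Conjugacy\<close>

text \<open>The first four conjuncts say that both sides are metric spaces with a self-map.\<close>

definition conjugate_systems ::
  "'a set \<Rightarrow> ('a \<Rightarrow> 'a \<Rightarrow> real) \<Rightarrow> ('a \<Rightarrow> 'a) \<Rightarrow> 'b set \<Rightarrow> ('b \<Rightarrow> 'b \<Rightarrow> real) \<Rightarrow> ('b \<Rightarrow> 'b) \<Rightarrow> bool" where
  "conjugate_systems M d f N d' f' \<longleftrightarrow>
     Metric_space M d \<and> Metric_space N d' \<and> f \<in> M \<rightarrow> M \<and> f' \<in> N \<rightarrow> N \<and>
     (\<exists>h. homeomorphic_map (Metric_space.mtopology M d) (Metric_space.mtopology N d') h \<and>
          (\<forall>x\<in>M. h (f x) = f' (h x)))"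

end

theory Submission
  imports Defs "HOL-Real_Asymp.Real_Asymp"
begin

text \<open>In the Klein model geodesics are Euclidean chords and the polygon is a convex polygon inscribed
  in the circle. A base arc \<open>(\<theta>, \<phi>)\<close> therefore leaves the polygon through side \<open>j\<close> iff \<open>\<phi>\<close> lies on the
  open boundary arc cut off by side \<open>j\<close> and \<open>\<theta>\<close> does not, and a bounce reflects both intercepts in
  side \<open>j\<close>. So the labels of the future of a trajectory are the itinerary of \<open>\<phi>\<close> under the map that
  applies to each boundary arc the reflection in its side, and the labels of its past are the
  itinerary of \<open>\<theta>\<close> under the same map.

  Everything reduces to this one-sided coding, and there the point is that the cylinders shrink.
  Seen from inside the polygon, the reflection in side \<open>j\<close> contracts the complement of the
  arc of \<open>j\<close>, strictly except at the two endpoints of that arc. Another closed arc contains at most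
  one of these endpoints, so two points of it that are at least \<open>\<epsilon>\<close> apart move closer by a
  uniform factor. Hence a closed chain of arcs shrinks to one point, and this point is
  a vertex iff the labels eventually alternate between the two sides meeting there.\<close>

section \<open>Reflections on the unit circle\<close>

text \<open>No fixed contraction rate can hold: the reflections in two adjacent sides compose to a
  parabolic map at their common ideal vertex, with derivative 1 there, so words that alternate for a
  long time have cylinders that do not shrink exponentially. Hence shrinking is proved indirectly:
  if the final images of two long chains were far apart, all their earlier pairs would be too, and
  every step would have contracted by a definite factor. Closed arcs are needed to get a limit point
  by compactness, and rule (2) is what keeps this limit off the ideal vertices. The metric in which
  no reflection expands the complement of its arc is built from the sum of squared distances to the
  vertices, because the change of that sum under a reflection is an exact algebraic identity. Such
  identities are checked between rational functions: on the unit circle \<open>cnj z\<close> is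
  \<open>1 / z\<close>, so signed areas and squared distances become rational in the points. In
  particular \<open>orient a b z\<close>, twice the signed area of the Euclidean triangle with
  vertices \<open>a\<close>, \<open>b\<close>, \<open>z\<close>, factors, and its sign tells apart
  the two arcs cut off by a chord.\<close>

definition orient :: "complex \<Rightarrow> complex \<Rightarrow> complex \<Rightarrow> real" where
  "orient a b z = Im (cnj a * b + cnj b * z + cnj z * a)"

text \<open>On the unit circle the hyperbolic reflection in the geodesic from \<open>a\<close> to \<open>b\<close> agrees with the
  holomorphic involution that fixes \<open>a\<close> and \<open>b\<close>, that is, with harmonic conjugation.\<close>

definition reflect_pt :: "complex \<Rightarrow> complex \<Rightarrow> complex \<Rightarrow> complex" where
  "reflect_pt a b z = ((a + b) * z - 2 * a * b) / (2 * z - (a + b))"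

text \<open>The isometry from the Poincare disc to the Klein disc; it fixes the boundary circle
  pointwise, so intercepts stay the same.\<close>

definition klein :: "complex \<Rightarrow> complex" where
  "klein z = (2 / (1 + (cmod z)\<^sup>2)) *\<^sub>R z"

lemma cnj_unit: "cmod z = 1 \<Longrightarrow> cnj z = 1 / z"
  by (metis complex_div_cnj div_by_1 mult_1 of_real_1 one_power2)

lemma unit_nonzero: "cmod z = 1 \<Longrightarrow> z \<noteq> 0"
  by auto

lemma of_real_Im_eq: "complex_of_real (Im z) = (z - cnj z) / (2 * \<i>)"
  by (simp add: complex_eq_iff)

text \<open>With conjugation replaced by inversion, the alternating expression splits into the three
  pairwise differences. Its zeros and its behaviour under a reflection can be read off from the
  factors.\<close>

lemma orient_unit:
  assumes "cmod a = 1" "cmod b = 1" "cmod z = 1"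
  shows "complex_of_real (orient a b z) = (b - a) * (b - z) * (z - a) / (2 * \<i> * a * b * z)"
proof -
  have "a \<noteq> 0" "b \<noteq> 0" "z \<noteq> 0" using assms by auto
  then show ?thesis
    unfolding orient_def of_real_Im_eq
    by (simp add: cnj_unit[OF assms(1)] cnj_unit[OF assms(2)] cnj_unit[OF assms(3)] field_simps)

qed

lemma norm_sub_unit:
  assumes "cmod z = 1" "cmod u = 1"
  shows "complex_of_real ((cmod (z - u))\<^sup>2) = - ((z - u)\<^sup>2) / (z * u)"
proof -
  have "z \<noteq> 0" "u \<noteq> 0" using assms by auto
  then show ?thesis
    unfolding complex_norm_square
    by (simp add: cnj_unit[OF assms(1)] cnj_unit[OF assms(2)] field_simps power2_eq_square)
qed

text \<open>The only pole is the midpoint of the chord, which lies strictly inside the circle: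
  equality in the triangle inequality would force \<open>a = b\<close>.\<close>

lemma reflect_pt_denominator_nonzero:
  assumes "cmod a = 1" "cmod b = 1" "a \<noteq> b" "cmod z = 1"
  shows "2 * z - (a + b) \<noteq> 0"
proof
  assume "2 * z - (a + b) = 0"
  then have "a + b = 2 * z" by simp
  then have "cmod (a + b) = cmod a + cmod b" using assms by (simp add: norm_mult)
  then show False using assms
    by (metis divide_self_if mult_cancel_left1 norm_triangle_eq scaleR_one zero_neq_one)
qed

lemma reflect_pt_mult:
  assumes "cmod a = 1" "cmod b = 1" "a \<noteq> b" "cmod z = 1"
  shows "reflect_pt a b z * (2 * z - (a + b)) = (a + b) * z - 2 * a * b"
  using reflect_pt_denominator_nonzero[OF assms] by (simp add: reflect_pt_def)

text \<open>Conjugation turns the numerator into the denominator up to the unimodular factor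
  \<open>- 1 / (a * b * z)\<close>.\<close>

lemma norm_reflect_pt:
  assumes "cmod a = 1" "cmod b = 1" "a \<noteq> b" "cmod z = 1"
  shows "cmod (reflect_pt a b z) = 1"
proof -
  have nz: "a \<noteq> 0" "b \<noteq> 0" "z \<noteq> 0" using assms by auto
  have "cmod ((a + b) * z - 2 * a * b) = cmod (cnj ((a + b) * z - 2 * a * b))"
    by (simp only: complex_mod_cnj)
  also have "cnj ((a + b) * z - 2 * a * b) = ((a + b) - 2 * z) / (a * b * z)"
    using nz by (simp add: cnj_unit[OF assms(1)] cnj_unit[OF assms(2)] cnj_unit[OF assms(4)] field_simps)
  also have "cmod \<dots> = cmod (2 * z - (a + b))"
    using assms by (simp add: norm_mult norm_divide norm_minus_commute)
  finally show ?thesis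
    using reflect_pt_denominator_nonzero[OF assms] by (simp add: reflect_pt_def norm_divide)
qed

lemma reflect_pt_endpoints:
  assumes "a \<noteq> b"
  shows "reflect_pt a b a = a" "reflect_pt a b b = b"
proof -
  have "2 * a - (a + b) \<noteq> 0" "2 * b - (a + b) \<noteq> 0" using assms by (auto simp: algebra_simps)
  then show "reflect_pt a b a = a" "reflect_pt a b b = b"
    by (simp_all add: reflect_pt_def divide_eq_eq algebra_simps)
qed

text \<open>The difference formula of a Moebius map; \<open>- ((a - b)\<^sup>2)\<close> is the
  determinant of its coefficient matrix.\<close>

lemma reflect_pt_diff:
  assumes "cmod a = 1" "cmod b = 1" "a \<noteq> b" "cmod z = 1" "cmod w = 1"
  shows "reflect_pt a b z - reflect_pt a b w
    = - ((a - b)\<^sup>2 * (z - w)) / ((2 * z - (a + b)) * (2 * w - (a + b)))"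
proof -
  have "(reflect_pt a b z - reflect_pt a b w) * ((2 * z - (a + b)) * (2 * w - (a + b)))
      = - ((a - b)\<^sup>2 * (z - w))"
    using reflect_pt_mult[OF assms(1-4)] reflect_pt_mult[OF assms(1-3,5)] by algebra
  then show ?thesis
    using reflect_pt_denominator_nonzero[OF assms(1-4)] reflect_pt_denominator_nonzero[OF assms(1-3,5)]
    by (intro iffD2[OF nonzero_eq_divide_eq]) simp_all
qed

lemma reflect_pt_reflect_pt:
  assumes "cmod a = 1" "cmod b = 1" "a \<noteq> b" "cmod z = 1"
  shows "reflect_pt a b (reflect_pt a b z) = z"
proof -
  let ?d = "2 * z - (a + b)"
  have d: "?d \<noteq> 0" by (rule reflect_pt_denominator_nonzero[OF assms])
  have 1: "(a + b) * reflect_pt a b z - 2 * a * b = (a - b)\<^sup>2 * z / ?d"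
    unfolding nonzero_eq_divide_eq[OF d]
    using reflect_pt_mult[OF assms] by algebra
  have 2: "2 * reflect_pt a b z - (a + b) = (a - b)\<^sup>2 / ?d"
    unfolding nonzero_eq_divide_eq[OF d]
    using reflect_pt_mult[OF assms] by algebra
  show ?thesis
    unfolding reflect_pt_def[of a b "reflect_pt a b z"] 1 2 using d assms by simp
qed

lemma norm_reflect_pt_denominator:
  assumes "cmod a = 1" "cmod b = 1" "a \<noteq> b" "cmod z = 1"
  shows "complex_of_real ((cmod (2 * z - (a + b)))\<^sup>2)
    = - ((2 * z - (a + b))\<^sup>2 * reflect_pt a b z) / (z * a * b)"
proof -
  have nz: "a \<noteq> 0" "b \<noteq> 0" "z \<noteq> 0" using assms by auto
  have d: "2 * z - (a + b) \<noteq> 0" by (rule reflect_pt_denominator_nonzero[OF assms])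
  have "cnj (2 * z - (a + b)) = - ((a + b) * z - 2 * a * b) / (z * a * b)"
    using nz by (simp add: cnj_unit[OF assms(1)] cnj_unit[OF assms(2)] cnj_unit[OF assms(4)] field_simps)
  also have "(a + b) * z - 2 * a * b = reflect_pt a b z * (2 * z - (a + b))"
    using d by (simp add: reflect_pt_def)
  finally show ?thesis
    unfolding complex_norm_square by (simp add: power2_eq_square)
qed

text \<open>With \<open>p = (z - a) (u - b)\<close> and \<open>q = (z - b) (u - a)\<close> this is
  \<open>(p + q)\<^sup>2 = (p - q)\<^sup>2 + 4 p q\<close>.\<close>

lemma reflect_pt_dist:
  assumes "cmod a = 1" "cmod b = 1" "a \<noteq> b" "cmod z = 1" "cmod u = 1"
  shows "(cmod (2 * z - (a + b)))\<^sup>2 * (cmod (reflect_pt a b z - u))\<^sup>2 * (cmod (a - b))\<^sup>2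
    = ((cmod (a - b))\<^sup>2)\<^sup>2 * (cmod (z - u))\<^sup>2 + 16 * orient a b z * orient a b u"
proof -
  have nz: "a \<noteq> 0" "b \<noteq> 0" "z \<noteq> 0" "u \<noteq> 0" using assms by auto
  let ?d = "2 * z - (a + b)" and ?r = "reflect_pt a b z"
  have d: "?d \<noteq> 0" by (rule reflect_pt_denominator_nonzero[OF assms(1-4)])
  have nr: "cmod ?r = 1" by (rule norm_reflect_pt[OF assms(1-4)])
  then have r0: "?r \<noteq> 0" by auto
  define p q where "p = (z - a) * (u - b)" and "q = (z - b) * (u - a)"
  have "?d * (?r - u) = - (p + q)"
    using reflect_pt_mult[OF assms(1-4)] unfolding p_def q_def by algebra
  then have E: "?d\<^sup>2 * (?r - u)\<^sup>2 = (p + q)\<^sup>2"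
    by (metis power2_minus power_mult_distrib)
  have F: "(a - b) * (z - u) = p - q" unfolding p_def q_def by (simp add: algebra_simps)
  then have F2: "(a - b)\<^sup>2 * (z - u)\<^sup>2 = (p - q)\<^sup>2" by (metis power_mult_distrib)
  have "complex_of_real ((cmod ?d)\<^sup>2 * (cmod (?r - u))\<^sup>2 * (cmod (a - b))\<^sup>2)
      = (- (?d\<^sup>2 * ?r) / (z * a * b)) * (- ((?r - u)\<^sup>2) / (?r * u)) * (- ((a - b)\<^sup>2) / (a * b))"
    by (simp only: of_real_mult norm_reflect_pt_denominator[OF assms(1-4)] norm_sub_unit[OF nr assms(5)]
        norm_sub_unit[OF assms(1,2)])
  also have "\<dots> = - ((a - b)\<^sup>2 * (?d\<^sup>2 * (?r - u)\<^sup>2)) / (z * u * (a * b)\<^sup>2)"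
    using r0 nz by (simp add: field_simps power2_eq_square)
  also have "\<dots> = - ((a - b)\<^sup>2 * ((a - b)\<^sup>2 * (z - u)\<^sup>2 + 4 * p * q)) / (z * u * (a * b)\<^sup>2)"
    unfolding E F2 by (simp add: power2_eq_square algebra_simps)
  also have "\<dots> = (- ((a - b)\<^sup>2) / (a * b))\<^sup>2 * (- ((z - u)\<^sup>2) / (z * u))
     + 16 * ((b - a) * (b - z) * (z - a) / (2 * \<i> * a * b * z))
          * ((b - a) * (b - u) * (u - a) / (2 * \<i> * a * b * u))"
  proof -
    have 1: "(- ((a - b)\<^sup>2) / (a * b))\<^sup>2 * (- ((z - u)\<^sup>2) / (z * u))
        = - ((a - b)\<^sup>2 * ((a - b)\<^sup>2 * (z - u)\<^sup>2)) / (z * u * (a * b)\<^sup>2)"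
      using nz by (simp add: field_simps power2_eq_square)
    have "16 * ((b - a) * (b - z) * (z - a) / (2 * \<i> * a * b * z))
          * ((b - a) * (b - u) * (u - a) / (2 * \<i> * a * b * u))
       = 16 * (((b - a) * (b - z) * (z - a)) * ((b - a) * (b - u) * (u - a)))
          / ((2 * \<i> * a * b * z) * (2 * \<i> * a * b * u))" by simp
    also have "(2 * \<i> * a * b * z) * (2 * \<i> * a * b * u) = - 4 * (z * u * (a * b)\<^sup>2)"
      by (simp add: power2_eq_square algebra_simps)
    also have "((b - a) * (b - z) * (z - a)) * ((b - a) * (b - u) * (u - a)) = (a - b)\<^sup>2 * (p * q)"
      unfolding p_def q_def by (simp add: power2_eq_square algebra_simps)
    also have "16 * ((a - b)\<^sup>2 * (p * q)) / (- 4 * (z * u * (a * b)\<^sup>2))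
       = - ((a - b)\<^sup>2 * (4 * p * q)) / (z * u * (a * b)\<^sup>2)"
      by (simp add: divide_simps)
    finally show ?thesis unfolding 1 by (simp add: add_divide_distrib[symmetric] algebra_simps)
  qed
  also have "\<dots> = complex_of_real
      (((cmod (a - b))\<^sup>2)\<^sup>2 * (cmod (z - u))\<^sup>2 + 16 * orient a b z * orient a b u)"
    by (simp only: of_real_add of_real_mult of_real_power[of "(cmod (a - b))\<^sup>2"]
        norm_sub_unit[OF assms(1,2)] norm_sub_unit[OF assms(4,5)]
        orient_unit[OF assms(1,2,4)] orient_unit[OF assms(1,2,5)] of_real_numeral)
  finally show ?thesis by (simp only: of_real_eq_iff)
qed

text \<open>The factors \<open>b - z\<close> and \<open>z - a\<close> of \<open>orient_unit\<close>
  are multiplied by \<open>(a - b) / d\<close> and \<open>(b - a) / d\<close>, where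
  \<open>d\<close> is the denominator of the reflection. Together with the formulas for the squared
  norms this leaves a negative real factor, so a reflection interchanges the two arcs.\<close>

lemma orient_reflect_pt:
  assumes "cmod a = 1" "cmod b = 1" "a \<noteq> b" "cmod z = 1"
  shows "orient a b (reflect_pt a b z) * (cmod (2 * z - (a + b)))\<^sup>2 = - ((cmod (a - b))\<^sup>2 * orient a b z)"
proof -
  have nz: "a \<noteq> 0" "b \<noteq> 0" "z \<noteq> 0" using assms by auto
  let ?d = "2 * z - (a + b)" and ?r = "reflect_pt a b z"
  have d: "?d \<noteq> 0" by (rule reflect_pt_denominator_nonzero[OF assms(1-4)])
  have nr: "cmod ?r = 1" by (rule norm_reflect_pt[OF assms(1-4)])
  then have r0: "?r \<noteq> 0" by auto
  have e1: "(b - ?r) * ?d = (a - b) * (b - z)"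
    using reflect_pt_mult[OF assms] by algebra
  have e2: "(?r - a) * ?d = (b - a) * (z - a)"
    using reflect_pt_mult[OF assms] by algebra
  have "complex_of_real (orient a b ?r * (cmod ?d)\<^sup>2)
      = (b - a) * (b - ?r) * (?r - a) / (2 * \<i> * a * b * ?r) * (- (?d\<^sup>2 * ?r) / (z * a * b))"
    by (simp only: of_real_mult norm_reflect_pt_denominator[OF assms(1-4)] orient_unit[OF assms(1,2) nr])
  also have "\<dots> = - ((b - a) * ((b - ?r) * ?d) * ((?r - a) * ?d)) / (2 * \<i> * a * b * (z * a * b))"
    using r0 nz by (simp add: divide_simps power2_eq_square)
  also have "\<dots> = - ((- ((a - b)\<^sup>2) / (a * b)) * ((b - a) * (b - z) * (z - a) / (2 * \<i> * a * b * z)))"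
    unfolding e1 e2 using nz by (simp add: divide_simps power2_eq_square, simp add: algebra_simps)
  also have "\<dots> = complex_of_real (- ((cmod (a - b))\<^sup>2 * orient a b z))"
    by (simp only: of_real_mult of_real_minus norm_sub_unit[OF assms(1,2)] orient_unit[OF assms(1,2,4)])
  finally show ?thesis by (simp only: of_real_eq_iff)
qed

section \<open>Moebius maps and the Klein model\<close>

lemma one_plus_cnj_mult_nonzero:
  assumes "cmod p < 1" "cmod x \<le> 1"
  shows "1 + cnj p * x \<noteq> 0"
proof
  assume "1 + cnj p * x = 0"
  then have "cnj p * x = - 1" by (simp add: add_eq_0_iff)
  then have "cmod p * cmod x = 1" by (metis complex_mod_cnj norm_minus_cancel norm_mult norm_one)
  moreover have "cmod p * cmod x \<le> cmod p * 1" by (intro mult_left_mono assms) simp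
  ultimately show False using assms by linarith
qed

lemma Moebius_uminus: "Moebius_function 0 (- p) x = (x + p) / (1 + cnj p * x)"
  by (simp add: Moebius_function_simple)

lemma norm_Moebius_unit:
  assumes "cmod p < 1" "cmod x = 1"
  shows "cmod (Moebius_function 0 p x) = 1"
proof -
  have "x \<noteq> 0" using assms by auto
  have nz: "1 - cnj p * x \<noteq> 0" using one_plus_cnj_mult_nonzero[of "-p" x] assms by simp
  have "cmod (x - p) = cmod (cnj (x - p) * x)" using assms by (simp add: norm_mult del: complex_cnj_diff)
  also have "cnj (x - p) * x = 1 - cnj p * x"
    using \<open>x \<noteq> 0\<close> by (simp add: cnj_unit[OF assms(2)] algebra_simps)
  finally show ?thesis using nz by (simp add: Moebius_function_simple norm_divide)
qed

lemma Moebius_inverse: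
  assumes "cmod p < 1" "cmod x \<le> 1"
  shows "Moebius_function 0 (- p) (Moebius_function 0 p x) = x"
proof -
  have nz: "1 - cnj p * x \<noteq> 0" using one_plus_cnj_mult_nonzero[of "-p" x] assms by simp
  have nz2: "1 - cnj p * p \<noteq> 0" using one_plus_cnj_mult_nonzero[of "-p" p] assms by simp
  have 1: "Moebius_function 0 p x + p = (1 - cnj p * p) * x / (1 - cnj p * x)"
    using nz by (simp add: Moebius_function_simple field_simps)
  have 2: "1 + cnj p * Moebius_function 0 p x = (1 - cnj p * p) / (1 - cnj p * x)"
    using nz by (simp add: Moebius_function_simple field_simps)
  show ?thesis unfolding Moebius_uminus 1 2 using nz nz2 by simp
qed

text \<open>Isometries conjugate reflections to reflections. With \<open>p\<close> moved to the
  origin the side is the diameter from \<open>- s\<close> to \<open>s\<close>, and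
  \<open>reflect_dir s\<close> is its reflection.\<close>

lemma reflect_pt_Moebius:
  assumes p: "cmod p < 1" and s: "cmod s = 1" and w: "cmod w = 1"
  shows "reflect_pt (Moebius_function 0 (- p) (- s)) (Moebius_function 0 (- p) s)
      (Moebius_function 0 (- p) w) = Moebius_function 0 (- p) (reflect_dir s w)"
proof -
  \<comment> \<open>\<open>q\<close> is treated as an indeterminate independent of \<open>p\<close>,
    which makes both sides rational functions.\<close>
  define q where "q = cnj p"
  have w0: "w \<noteq> 0" using w by auto
  have ds: "1 + q * s \<noteq> 0" "1 - q * s \<noteq> 0" "1 + q * w \<noteq> 0"
    using one_plus_cnj_mult_nonzero[OF p, of s] one_plus_cnj_mult_nonzero[OF p, of "- s"]
      one_plus_cnj_mult_nonzero[OF p, of w] s w by (auto simp: q_def)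
  have pq: "1 - p * q \<noteq> 0"
    using one_plus_cnj_mult_nonzero[of p "-p"] p by (simp add: q_def mult.commute)
  define a b z where "a = (p - s) / (1 - q * s)" and "b = (p + s) / (1 + q * s)"
    and "z = (w + p) / (1 + q * w)"
  have r: "reflect_dir s w = s\<^sup>2 / w" by (simp add: reflect_dir_def cnj_unit[OF w])
  have nr: "cmod (s\<^sup>2 / w) = 1" using s w by (simp add: norm_divide norm_power)
  have d1: "1 + q * (s\<^sup>2 / w) \<noteq> 0"
    using one_plus_cnj_mult_nonzero[OF p, of "s\<^sup>2 / w"] nr by (simp add: q_def)
  then have d2: "w + q * s\<^sup>2 \<noteq> 0" using w0 by (simp add: field_simps)
  have M: "Moebius_function 0 (- p) (- s) = a" "Moebius_function 0 (- p) s = b"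
    "Moebius_function 0 (- p) w = z"
    unfolding Moebius_uminus a_def b_def z_def q_def by (simp_all add: add.commute)
  have M2: "Moebius_function 0 (- p) (reflect_dir s w) = (s\<^sup>2 + p * w) / (w + q * s\<^sup>2)"
  proof -
    have "s\<^sup>2 / w + p = (s\<^sup>2 + p * w) / w" "1 + q * (s\<^sup>2 / w) = (w + q * s\<^sup>2) / w"
      using w0 by (simp_all add: field_simps)
    then show ?thesis unfolding Moebius_uminus r q_def using w0 by simp
  qed
  let ?D = "(1 + q * s) * (1 - q * s)"
  have ab: "a + b = 2 * (p - q * s\<^sup>2) / ?D"
    unfolding a_def b_def using ds by (simp add: add_frac_eq power2_eq_square algebra_simps)
  have ab2: "a * b = (p\<^sup>2 - s\<^sup>2) / ?D"
    unfolding a_def b_def by (simp add: power2_eq_square algebra_simps)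
  have "2 * z - (a + b) = 2 * ((w + p) * ?D - (p - q * s\<^sup>2) * (1 + q * w)) / ((1 + q * w) * ?D)"
    unfolding ab z_def using ds by (simp add: diff_frac_eq) (simp add: algebra_simps)
  also have "(w + p) * ?D - (p - q * s\<^sup>2) * (1 + q * w) = (w + q * s\<^sup>2) * (1 - p * q)"
    by algebra
  finally have e1: "2 * z - (a + b) = 2 * ((w + q * s\<^sup>2) * (1 - p * q)) / ((1 + q * w) * ?D)" .
  have "(a + b) * z - 2 * a * b = (a + b) * z - 2 * (a * b)" by simp
  also have "\<dots> = 2 * ((p - q * s\<^sup>2) * (w + p) - (p\<^sup>2 - s\<^sup>2) * (1 + q * w)) / ((1 + q * w) * ?D)"
  proof -
    have "2 * (a * b) = 2 * (p\<^sup>2 - s\<^sup>2) * (1 + q * w) / ((1 + q * w) * ?D)"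
      unfolding ab2 using ds by simp
    moreover have "(a + b) * z = 2 * (p - q * s\<^sup>2) * (w + p) / ((1 + q * w) * ?D)"
      unfolding ab z_def by simp
    ultimately show ?thesis
      by (simp only: diff_divide_distrib[symmetric] right_diff_distrib[symmetric] mult.assoc)
  qed
  also have "(p - q * s\<^sup>2) * (w + p) - (p\<^sup>2 - s\<^sup>2) * (1 + q * w) = (s\<^sup>2 + p * w) * (1 - p * q)"
    by algebra
  finally have e2: "(a + b) * z - 2 * a * b
    = 2 * ((s\<^sup>2 + p * w) * (1 - p * q)) / ((1 + q * w) * ?D)" .
  show ?thesis
    unfolding M M2 reflect_pt_def e1 e2 using ds pq d2 by simp
qed

section \<open>Half-planes and geodesics in Klein coordinates\<close>

lemma orient_klein:
  "(1 + (cmod z)\<^sup>2) * orient a b (klein z)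
    = (1 + (cmod z)\<^sup>2) * Im (cnj a * b) + 2 * Im (cnj b * z + cnj z * a)"
proof -
  define c where "c = 2 / (1 + (cmod z)\<^sup>2)"
  have "1 + (cmod z)\<^sup>2 \<noteq> 0" by (smt (verit) zero_le_power2)
  then have c: "(1 + (cmod z)\<^sup>2) * c = 2" unfolding c_def by (rule nonzero_mult_div_cancel_left[of "1 + (cmod z)\<^sup>2" 2, unfolded times_divide_eq_right[symmetric]])
  have "orient a b (klein z) = Im (cnj a * b) + c * Im (cnj b * z + cnj z * a)"
    unfolding orient_def klein_def c_def[symmetric] by (simp add: algebra_simps)
  then show ?thesis using c by (simp only: distrib_left mult.assoc[symmetric])
qed

text \<open>The gain of the Klein model: along a chord the side condition is a linear interpolation
  between its values at the intercepts.\<close>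

lemma orient_affine:
  "orient a b ((1 - u) *\<^sub>R x + u *\<^sub>R y) = (1 - u) * orient a b x + u * orient a b y"
  unfolding orient_def by (simp add: algebra_simps)

text \<open>Seen from \<open>z\<close>, the sine of the angle between the intercepts is a positive
  multiple of a Euclidean signed area, so hyperbolic half-planes become Euclidean ones. The product
  under \<open>Im\<close> is unimodular, so its conjugate is its inverse \<open>V / U\<close>, and
  the imaginary part splits into \<open>U - V\<close> and \<open>U + V\<close>.\<close>

lemma Im_Moebius:
  assumes a: "cmod a = 1" and b: "cmod b = 1" and z: "cmod z < 1"
  shows "Im (cnj (Moebius_function 0 z a) * Moebius_function 0 z b)
      * ((cmod (a - z))\<^sup>2 * (cmod (b - z))\<^sup>2)
    = (1 - (cmod z)\<^sup>2) * ((1 + (cmod z)\<^sup>2) * orient a b (klein z))"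
proof -
  have nz: "a \<noteq> 0" "b \<noteq> 0" using a b by auto
  have ne: "a - z \<noteq> 0" "b - z \<noteq> 0" using a b z by auto
  define y where "y = cnj z"
  have da: "1 - y * a \<noteq> 0" and db: "1 - y * b \<noteq> 0"
    using one_plus_cnj_mult_nonzero[of "-z"] a b z by (auto simp: y_def)
  define U V where "U = (1 - y * a) * (b - z)" and "V = (a - z) * (1 - y * b)"
  have UV: "U \<noteq> 0" "V \<noteq> 0" unfolding U_def V_def using ne da db by auto
  let ?X = "cnj (Moebius_function 0 z a) * Moebius_function 0 z b"
  have ca: "cnj (Moebius_function 0 z a) = (1 - y * a) / (a - z)"
    and cb: "cnj (Moebius_function 0 z b) = (1 - y * b) / (b - z)"
  proof -
    have "cnj (Moebius_function 0 z u) = (1 - y * u) / (u - z)" if u: "cmod u = 1" for u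
    proof -
      have "u \<noteq> 0" using u by auto
      then have "1 - y * u = u * (1 / u - y)" "u - z = u * (1 - z * (1 / u))"
        by (simp_all add: field_simps)
      then show ?thesis using \<open>u \<noteq> 0\<close> by (simp add: Moebius_function_simple cnj_unit[OF u] y_def)
    qed
    then show "cnj (Moebius_function 0 z a) = (1 - y * a) / (a - z)"
      "cnj (Moebius_function 0 z b) = (1 - y * b) / (b - z)" using a b by auto
  qed
  have X: "?X = U / V"
    unfolding ca U_def V_def by (simp add: Moebius_function_simple y_def)
  have X2: "cnj ?X = V / U"
    unfolding complex_cnj_mult complex_cnj_cnj cb U_def V_def
    by (simp add: Moebius_function_simple y_def)
  have I: "complex_of_real (Im ?X) = (U\<^sup>2 - V\<^sup>2) / (2 * \<i> * U * V)"
    unfolding of_real_Im_eq X2 unfolding X using UV by (simp add: field_simps power2_eq_square)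
  have na: "complex_of_real ((cmod (a - z))\<^sup>2) = (a - z) * (1 - y * a) / a"
    unfolding complex_norm_square using nz by (simp add: cnj_unit[OF a] y_def field_simps)
  have nb: "complex_of_real ((cmod (b - z))\<^sup>2) = (b - z) * (1 - y * b) / b"
    unfolding complex_norm_square using nz by (simp add: cnj_unit[OF b] y_def field_simps)
  have nzz: "complex_of_real ((cmod z)\<^sup>2) = z * y"
    unfolding complex_norm_square y_def by simp
  have "complex_of_real (Im ?X * ((cmod (a - z))\<^sup>2 * (cmod (b - z))\<^sup>2))
      = (U\<^sup>2 - V\<^sup>2) / (2 * \<i> * U * V) * ((a - z) * (1 - y * a) / a * ((b - z) * (1 - y * b) / b))"
    by (simp only: of_real_mult I na nb)
  also have "(a - z) * (1 - y * a) / a * ((b - z) * (1 - y * b) / b) = U * V / (a * b)"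
    unfolding U_def V_def by simp
  also have "(U\<^sup>2 - V\<^sup>2) / (2 * \<i> * U * V) * (U * V / (a * b)) = (U - V) * (U + V) / (2 * \<i> * a * b)"
  proof -
    have "X / (K * U * V) * (U * V / (a * b)) = X / (K * a * b)" for X K :: complex
      using UV by simp
    moreover have "U\<^sup>2 - V\<^sup>2 = (U - V) * (U + V)"
      by (simp add: power2_eq_square algebra_simps)
    ultimately show ?thesis by (simp only:)
  qed
  also have "U - V = (b - a) * (1 - z * y)"
    unfolding U_def V_def by (simp add: algebra_simps)
  also have "U + V = (a + b) * (1 + z * y) - 2 * z - 2 * y * a * b"
    unfolding U_def V_def by (simp add: algebra_simps)
  also have "(b - a) * (1 - z * y) * ((a + b) * (1 + z * y) - 2 * z - 2 * y * a * b) / (2 * \<i> * a * b)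
     = (1 - z * y) * ((1 + z * y) * ((b / a - a / b) / (2 * \<i>))
         + 2 * ((z / b + y * a - (y * b + z / a)) / (2 * \<i>)))"
    using nz by (simp add: field_simps power2_eq_square)
  also have "(b / a - a / b) / (2 * \<i>) = complex_of_real (Im (cnj a * b))"
    unfolding of_real_Im_eq using nz by (simp add: cnj_unit[OF a] cnj_unit[OF b])
  also have "(z / b + y * a - (y * b + z / a)) / (2 * \<i>) = complex_of_real (Im (cnj b * z + cnj z * a))"
    unfolding of_real_Im_eq using nz by (simp add: cnj_unit[OF a] cnj_unit[OF b] y_def algebra_simps)
  also have "(1 - z * y) * ((1 + z * y) * complex_of_real (Im (cnj a * b))
         + 2 * complex_of_real (Im (cnj b * z + cnj z * a)))
     = complex_of_real ((1 - (cmod z)\<^sup>2) * ((1 + (cmod z)\<^sup>2) * orient a b (klein z)))"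
    unfolding orient_klein by (simp only: of_real_mult of_real_add of_real_diff nzz of_real_1 of_real_numeral)
  finally show ?thesis by (simp only: of_real_eq_iff)
qed

lemma norm_power2_less_1: "cmod z < 1 \<Longrightarrow> (cmod z)\<^sup>2 < 1"
  by (simp add: power_less_one_iff)

lemma Im_Moebius_sign:
  assumes "cmod a = 1" "cmod b = 1" "cmod z < 1"
  obtains c where "c > 0"
    "Im (cnj (Moebius_function 0 z a) * Moebius_function 0 z b) = c * orient a b (klein z)"
proof -
  have ne: "a - z \<noteq> 0" "b - z \<noteq> 0" using assms by auto
  let ?n = "(cmod (a - z))\<^sup>2 * (cmod (b - z))\<^sup>2"
  have n: "?n > 0" using ne by simp
  have m: "0 < (1 - (cmod z)\<^sup>2) * (1 + (cmod z)\<^sup>2)"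
    using norm_power2_less_1[OF assms(3)] by (intro mult_pos_pos) (auto intro: add_pos_nonneg)
  show ?thesis
  proof (rule that)
    show "0 < (1 - (cmod z)\<^sup>2) * (1 + (cmod z)\<^sup>2) / ?n" using m n by (rule divide_pos_pos)
    show "Im (cnj (Moebius_function 0 z a) * Moebius_function 0 z b)
      = (1 - (cmod z)\<^sup>2) * (1 + (cmod z)\<^sup>2) / ?n * orient a b (klein z)"
      using n Im_Moebius[OF assms]
      by (metis less_irrefl mult.assoc nonzero_eq_divide_eq times_divide_eq_left)
  qed
qed

lemma left_halfplane_iff:
  assumes "cmod a = 1" "cmod b = 1"
  shows "z \<in> left_halfplane (a, b) \<longleftrightarrow> cmod z < 1 \<and> 0 \<le> orient a b (klein z)"
proof (cases "cmod z < 1")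
  case True
  obtain c where "c > 0"
    "Im (cnj (Moebius_function 0 z a) * Moebius_function 0 z b) = c * orient a b (klein z)"
    using Im_Moebius_sign[OF assms True] .
  then show ?thesis
    using True unfolding left_halfplane_def mem_Collect_eq fst_conv snd_conv
    by (auto simp only: zero_le_mult_iff mem_ball_0)
next
  case False
  then show ?thesis by (simp add: left_halfplane_def)
qed

text \<open>After moving \<open>p\<close> to the origin a geodesic through \<open>p\<close> is a
  diameter: the quotient of its ends is unimodular and real, and 1 is excluded because the Moebius
  map is injective.\<close>

lemma Moebius_antipodal:
  assumes "cmod a = 1" "cmod b = 1" "a \<noteq> b" "cmod p < 1" "orient a b (klein p) = 0"
  shows "Moebius_function 0 p a = - Moebius_function 0 p b"
proof -
  let ?a = "Moebius_function 0 p a" and ?b = "Moebius_function 0 p b"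
  have n: "cmod ?a = 1" "cmod ?b = 1" using norm_Moebius_unit assms by auto
  have "Im (cnj ?a * ?b) = 0" using Im_Moebius_sign[OF assms(1,2,4)] assms(5) by (metis mult_zero_right)
  moreover have "cmod (cnj ?a * ?b) = 1" using n by (simp add: norm_mult)
  ultimately have "cnj ?a * ?b = 1 \<or> cnj ?a * ?b = -1"
    by (metis abs_eq_iff' complex_eq_iff complex_is_Real_iff in_Reals_norm Im_complex_of_real
        one_complex.simps uminus_complex.simps neg_0_equal_iff_equal abs_1)
  then have "?b = ?a \<or> ?b = - ?a"
    using n unit_nonzero[of ?a] by (auto simp: cnj_unit field_simps)
  moreover have "?a \<noteq> ?b"
    using Moebius_inverse[OF assms(4), of a] Moebius_inverse[OF assms(4), of b] assms by fastforce
  ultimately show ?thesis by auto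
qed

text \<open>For \<open>p = 0\<close> the weights are \<open>(1 + tanh (t / 2))\<^sup>2\<close> and
  \<open>(1 - tanh (t / 2))\<^sup>2\<close>. Acting on the hyperboloid model, the Moebius map
  rescales the light-like vectors over \<open>w\<close> and \<open>- w\<close>, up to a common
  factor, by \<open>(cmod (1 + cnj p * w))\<^sup>2\<close> and
  \<open>(cmod (1 - cnj p * w))\<^sup>2\<close>.\<close>

lemma klein_geodesic:
  fixes p w :: complex and t :: real
  assumes p: "cmod p < 1" and w: "cmod w = 1"
  defines "A \<equiv> (1 + tanh (t / 2))\<^sup>2 * (cmod (1 + cnj p * w))\<^sup>2"
    and "B \<equiv> (1 - tanh (t / 2))\<^sup>2 * (cmod (1 - cnj p * w))\<^sup>2"
  shows "0 < A" "0 < B"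
    and "klein (geodesic p w t) = (1 - A / (A + B)) *\<^sub>R Moebius_function 0 (- p) (- w)
      + (A / (A + B)) *\<^sub>R Moebius_function 0 (- p) w"
    and "cmod (geodesic p w t) < 1"
proof -
  define q where "q = cnj p"
  define \<tau> where "\<tau> = tanh (t / 2)"
  define T where "T = complex_of_real \<tau>"
  have tau: "\<bar>\<tau>\<bar> < 1" unfolding \<tau>_def using tanh_real_lt_1[of "t/2"] tanh_real_gt_neg1[of "t/2"] by linarith
  have w0: "w \<noteq> 0" using w by auto
  have d: "1 + q * w \<noteq> 0" "1 - q * w \<noteq> 0"
    using one_plus_cnj_mult_nonzero[OF p, of w] one_plus_cnj_mult_nonzero[OF p, of "-w"] w
    by (auto simp: q_def)
  show A: "0 < A" and B: "0 < B"
    using d tau unfolding A_def B_def \<tau>_def[symmetric] q_def by auto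
  have "cmod (T * w) < 1" using tau w by (simp add: T_def norm_mult)
  then have e: "1 + q * (T * w) \<noteq> 0" "cmod (Moebius_function 0 (- p) (T * w)) < 1"
    using one_plus_cnj_mult_nonzero[OF p, of "T * w"] Moebius_function_norm_lt_1[of "-p" "T * w" 0] p
    by (auto simp: q_def)
  let ?z = "geodesic p w t"
  have z: "?z = (T * w + p) / (1 + q * (T * w))"
    unfolding geodesic_def Moebius_uminus scaleR_conv_of_real T_def q_def \<tau>_def by simp
  show "cmod ?z < 1"
    using e(2) unfolding geodesic_def scaleR_conv_of_real T_def \<tau>_def by simp
  \<comment> \<open>\<open>N\<close> is the squared modulus of the denominator of the point.
    \<open>A + B\<close> will be \<open>2 * (1 + (cmod ?z)\<^sup>2) * N\<close> and the weighted sum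
    of the ends \<open>4 * ?z * N\<close>; their quotient is \<open>klein ?z\<close>.\<close>
  define N where "N = (1 + q * T * w) * (1 + p * T / w)"
  have N: "complex_of_real ((cmod (1 + q * (T * w)))\<^sup>2) = N"
    unfolding complex_norm_square N_def using w0
    by (simp add: cnj_unit[OF w] q_def T_def)
  then have N0: "N \<noteq> 0" using e(1) by (metis norm_eq_zero of_real_eq_0_iff power_eq_0_iff)
  have cz: "cnj ?z = (T / w + q) / (1 + p * T / w)"
    unfolding z by (simp add: cnj_unit[OF w] q_def T_def)
  have nz2: "1 + p * T / w \<noteq> 0" using N0 unfolding N_def by auto
  have n1: "complex_of_real (1 + (cmod ?z)\<^sup>2) * N = N + (T * w + p) * (T / w + q)"
  proof -
    have "(1 + X / R * (Y / S)) * (R * S) = R * S + X * Y" if "R \<noteq> 0" "S \<noteq> 0" for R S X Y :: complex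
      using that by (simp add: field_simps)
    from this[OF e(1) nz2] show ?thesis
      unfolding of_real_add complex_norm_square cz unfolding z N_def by (simp add: mult.assoc)
  qed
  have n2: "?z * N = (T * w + p) * (1 + p * T / w)"
    unfolding z N_def using e(1) by (simp add: mult.assoc)
  have CA: "complex_of_real A = (1 + T)\<^sup>2 * ((1 + q * w) * (1 + p / w))"
    unfolding A_def of_real_mult complex_norm_square
    by (simp add: cnj_unit[OF w] q_def T_def \<tau>_def)
  have CB: "complex_of_real B = (1 - T)\<^sup>2 * ((1 - q * w) * (1 - p / w))"
    unfolding B_def of_real_mult complex_norm_square
    by (simp add: cnj_unit[OF w] q_def T_def \<tau>_def)
  have AB: "complex_of_real (A + B) = 2 * (complex_of_real (1 + (cmod ?z)\<^sup>2) * N)"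
    unfolding n1 of_real_add[of A B] CA CB unfolding N_def using w0 by (simp add: field_simps power2_eq_square)
  have M1: "(1 + q * w) * (1 + p / w) * Moebius_function 0 (- p) w = (w + p) * (1 + p / w)"
    unfolding Moebius_uminus using d by (simp add: q_def)
  have M2: "(1 - q * w) * (1 - p / w) * Moebius_function 0 (- p) (- w) = (p - w) * (1 - p / w)"
    unfolding Moebius_uminus using d by (simp add: q_def)
  have "complex_of_real A * Moebius_function 0 (- p) w + complex_of_real B * Moebius_function 0 (- p) (- w)
     = (1 + T)\<^sup>2 * ((w + p) * (1 + p / w)) + (1 - T)\<^sup>2 * ((p - w) * (1 - p / w))"
    unfolding CA CB by (simp only: mult.assoc M1[unfolded mult.assoc] M2[unfolded mult.assoc])
  also have "\<dots> = 4 * (?z * N)"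
    unfolding n2 using w0 by (simp add: field_simps power2_eq_square)
  finally have num: "complex_of_real A * Moebius_function 0 (- p) w
      + complex_of_real B * Moebius_function 0 (- p) (- w) = 4 * (?z * N)" .
  have AB0: "A + B > 0" using A B by simp
  have "1 + (cmod ?z)\<^sup>2 > 0" by (smt (verit) zero_le_power2)
  then have z1: "complex_of_real (1 + (cmod ?z)\<^sup>2) \<noteq> 0" by (simp only: of_real_eq_0_iff)
  have "klein ?z = 2 * ?z / complex_of_real (1 + (cmod ?z)\<^sup>2)"
    unfolding klein_def scaleR_conv_of_real by simp
  also have "\<dots> = 4 * (?z * N) / (2 * (complex_of_real (1 + (cmod ?z)\<^sup>2) * N))"
  proof -
    have "2 * x / c = 4 * (x * N) / (2 * (c * N))" if "c \<noteq> 0" for x c :: complex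
      using N0 that by (simp add: field_simps)
    from this[OF z1] show ?thesis .
  qed
  also have "\<dots> = (complex_of_real A * Moebius_function 0 (- p) w
      + complex_of_real B * Moebius_function 0 (- p) (- w)) / complex_of_real (A + B)"
    unfolding AB num ..
  also have "\<dots> = (B / (A + B)) *\<^sub>R Moebius_function 0 (- p) (- w)
      + (A / (A + B)) *\<^sub>R Moebius_function 0 (- p) w"
    unfolding scaleR_conv_of_real by (simp add: add_divide_distrib)
  also have "B / (A + B) = 1 - A / (A + B)" using AB0 by (simp add: field_simps)
  finally show "klein ?z = (1 - A / (A + B)) *\<^sub>R Moebius_function 0 (- p) (- w)
      + (A / (A + B)) *\<^sub>R Moebius_function 0 (- p) w" .
qed

lemma klein_surj:
  assumes "cmod x < 1"
  obtains p where "cmod p < 1" "klein p = x"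
proof
  \<comment> \<open>The root below 1 of \<open>2 * r / (1 + r * r) = cmod x\<close> is
    \<open>r = cmod x / (1 + s)\<close>.\<close>
  define s where "s = sqrt (1 - (cmod x)\<^sup>2)"
  have x2: "(cmod x)\<^sup>2 < 1" using norm_power2_less_1[OF assms] .
  have s: "s > 0" "s\<^sup>2 = 1 - (cmod x)\<^sup>2" using x2 by (auto simp: s_def)
  let ?p = "(1 / (1 + s)) *\<^sub>R x"
  have np: "cmod ?p = cmod x / (1 + s)" using s by simp
  show "cmod ?p < 1" unfolding np using assms s by (simp add: field_simps)
  have "1 + (cmod ?p)\<^sup>2 = 2 / (1 + s)"
  proof -
    have "1 + (cmod ?p)\<^sup>2 = 1 + (1 - s\<^sup>2) / (1 + s)\<^sup>2"
      unfolding np power_divide using s by simp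
    also have "1 - s\<^sup>2 = (1 - s) * (1 + s)" by (simp add: power2_eq_square algebra_simps)
    also have "1 + (1 - s) * (1 + s) / (1 + s)\<^sup>2 = 2 / (1 + s)"
      using s by (simp add: power2_eq_square add_divide_eq_iff)
    finally show ?thesis .
  qed
  then show "klein ?p = x" unfolding klein_def using s by simp
qed

text \<open>\<open>tanh (t / 2)\<close> tends to 1 or to - 1, and the Moebius map extends
  continuously to the circle, so the limits are values of that map.\<close>

lemma passes_iff:
  "passes p w e \<longleftrightarrow> cmod p < 1 \<and> cmod w = 1 \<and>
     fst e = Moebius_function 0 (- p) (- w) \<and> snd e = Moebius_function 0 (- p) w"
proof (cases "cmod p < 1 \<and> cmod w = 1")
  case True
  then have p: "cmod p < 1" and w: "cmod w = 1" by auto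
  have d: "1 + cnj p * w \<noteq> 0" "1 - cnj p * w \<noteq> 0"
    using one_plus_cnj_mult_nonzero[OF p, of w] one_plus_cnj_mult_nonzero[OF p, of "-w"] w by auto
  have lim: "(geodesic p w \<longlongrightarrow> Moebius_function 0 (- p) (c *\<^sub>R w)) F"
    if "((\<lambda>t. tanh (t / 2)) \<longlongrightarrow> c) F" "\<bar>c\<bar> = 1" for c :: real and F
  proof -
    have "1 + cnj p * (c *\<^sub>R w) \<noteq> 0"
      by (rule one_plus_cnj_mult_nonzero[OF p]) (use w that in simp)
    then show ?thesis unfolding geodesic_def[abs_def] Moebius_uminus
      by (intro tendsto_intros that(1))
  qed
  have "filterlim (\<lambda>t::real. t / 2) at_top at_top" "filterlim (\<lambda>t::real. t / 2) at_bot at_bot"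
    by real_asymp+
  then have "((\<lambda>t::real. tanh (t / 2)) \<longlongrightarrow> 1) at_top" "((\<lambda>t::real. tanh (t / 2)) \<longlongrightarrow> -1) at_bot"
    by (auto intro: filterlim_compose[OF tanh_real_at_top] filterlim_compose[OF tanh_real_at_bot])
  then have l: "(geodesic p w \<longlongrightarrow> Moebius_function 0 (- p) w) at_top"
    "(geodesic p w \<longlongrightarrow> Moebius_function 0 (- p) (- w)) at_bot"
    using lim[of 1 at_top] lim[of "-1" at_bot] by simp_all
  have "trivial_limit (at_top :: real filter) = False" "trivial_limit (at_bot :: real filter) = False"
    by auto
  then show ?thesis
    using l tendsto_unique[of at_top "geodesic p w"] tendsto_unique[of at_bot "geodesic p w"] True
    unfolding passes_def by auto
qed (auto simp: passes_def)

lemma geodesic_0 [simp]: "geodesic p w 0 = p"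
  by (simp add: geodesic_def Moebius_uminus)

section \<open>The sides of an ideal polygon and their boundary arcs\<close>

lemma orient_endpoints [simp]: "orient a b a = 0" "orient a b b = 0"
  unfolding orient_def by (simp_all add: algebra_simps)

lemma orient_eq_0_iff:
  assumes "cmod a = 1" "cmod b = 1" "a \<noteq> b" "cmod z = 1"
  shows "orient a b z = 0 \<longleftrightarrow> z = a \<or> z = b"
proof -
  have nz: "a \<noteq> 0" "b \<noteq> 0" "z \<noteq> 0" using assms by auto
  have "orient a b z = 0 \<longleftrightarrow> complex_of_real (orient a b z) = 0" by simp
  also have "\<dots> \<longleftrightarrow> z = a \<or> z = b"
    unfolding orient_unit[OF assms(1,2,4)] using nz assms(3) by auto
  finally show ?thesis .
qed

text \<open>The area of an inscribed triangle in terms of its half arcs. The sign of each sine is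
  given by the order of the two angles as long as these lie within one turn.\<close>

lemma orient_cis:
  "orient (cis a) (cis b) (cis t) = 4 * sin ((b - a) / 2) * sin ((t - b) / 2) * sin ((t - a) / 2)"
proof -
  define x y where "x = (b - a) / 2" and "y = (t - b) / 2"
  have eq: "b - a = 2 * x" "t - b = 2 * y" "a - t = - (2 * (x + y))" "(t - a) / 2 = x + y"
    unfolding x_def y_def by (auto simp: field_simps)
  have "orient (cis a) (cis b) (cis t) = sin (b - a) + sin (t - b) + sin (a - t)"
    unfolding orient_def cis_cnj cis_mult by (simp add: algebra_simps)
  also have "\<dots> = sin (2 * x) + sin (2 * y) - sin (2 * (x + y))" unfolding eq sin_minus by simp
  also have "\<dots> = 2 * sin x * cos x * (1 - (cos y)\<^sup>2 + (sin y)\<^sup>2) + 2 * sin y * cos y * (1 - (cos x)\<^sup>2 + (sin x)\<^sup>2)"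
    unfolding distrib_left sin_add sin_double cos_double by (simp add: algebra_simps)
  also have "\<dots> = 2 * sin x * cos x * (2 * (sin y)\<^sup>2) + 2 * sin y * cos y * (2 * (sin x)\<^sup>2)"
    unfolding cos_squared_eq by simp
  also have "\<dots> = 4 * sin x * sin y * sin (x + y)"
    unfolding sin_add by (simp add: algebra_simps power2_eq_square)
  finally show ?thesis unfolding eq by simp
qed

lemma sin_half_sign:
  assumes "- 2 * pi < x" "x < 2 * pi"
  shows "sin (x / 2) > 0 \<longleftrightarrow> x > 0" "sin (x / 2) < 0 \<longleftrightarrow> x < 0"
proof -
  have 1: "sin (x / 2) > 0" if "x > 0" using that assms by (intro sin_gt_zero) auto
  have 2: "sin (x / 2) < 0" if "x < 0"
    using sin_gt_zero[of "- x / 2"] that assms by auto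
  show "sin (x / 2) > 0 \<longleftrightarrow> x > 0" "sin (x / 2) < 0 \<longleftrightarrow> x < 0"
    using 1 2 by (cases "x = 0"; force)+
qed

locale ideal_polygon =
  fixes k :: nat and v :: "nat \<Rightarrow> complex"
  assumes vertices: "ideal_polygon_vertices k v"
begin

abbreviation nxt :: "nat \<Rightarrow> nat" where "nxt \<equiv> next_label k"

abbreviation labels :: "nat set" where "labels \<equiv> {1..k}"

definition side_fun :: "nat \<Rightarrow> complex \<Rightarrow> real" where
  "side_fun j z = orient (v j) (v (nxt j)) z"

definition side_refl :: "nat \<Rightarrow> complex \<Rightarrow> complex" where
  "side_refl j z = reflect_pt (v j) (v (nxt j)) z"

definition arc :: "nat \<Rightarrow> complex set" where
  "arc j = {z. cmod z = 1 \<and> side_fun j z < 0}"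

definition closed_arc :: "nat \<Rightarrow> complex set" where
  "closed_arc j = {z. cmod z = 1 \<and> side_fun j z \<le> 0}"

abbreviation verts :: "complex set" where "verts \<equiv> v ` labels"

lemma three_le: "3 \<le> k"
  using vertices by (simp add: ideal_polygon_vertices_def)

lemma nxt_in: "j \<in> labels \<Longrightarrow> nxt j \<in> labels"
  using three_le by (auto simp: next_label_def)

lemma nxt_neq: "j \<in> labels \<Longrightarrow> nxt j \<noteq> j"
  using three_le by (auto simp: next_label_def)

lemma nxt_nxt_neq: "j \<in> labels \<Longrightarrow> nxt (nxt j) \<noteq> j"
  using three_le by (auto simp: next_label_def)

lemma nxt_inj: "i \<in> labels \<Longrightarrow> j \<in> labels \<Longrightarrow> nxt i = nxt j \<Longrightarrow> i = j"
  unfolding next_label_def by (cases "i = k"; cases "j = k") auto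

section \<open>Angular coordinates of the vertices and arcs\<close>

lemma norm_v: "j \<in> labels \<Longrightarrow> cmod (v j) = 1"
  using vertices by (force simp: ideal_polygon_vertices_def)

text \<open>The extra index \<open>k + 1\<close> repeats vertex 1 one full turn later, so that every
  side, the last one included, spans the angles from \<open>\<beta> j\<close> to
  \<open>\<beta> (j + 1)\<close>.\<close>

definition angle_lift :: "(nat \<Rightarrow> real) \<Rightarrow> bool" where
  "angle_lift \<beta> \<longleftrightarrow> strict_mono_on {1..k+1} \<beta> \<and> \<beta> (k + 1) = \<beta> 1 + 2 * pi \<and>
     (\<forall>j\<in>labels. v j = cis (\<beta> j) \<and> v (nxt j) = cis (\<beta> (j + 1)))"

lemma angle_liftD:
  assumes "angle_lift \<beta>"
  shows "strict_mono_on {1..k+1} \<beta>" "\<beta> (k + 1) = \<beta> 1 + 2 * pi"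
    "j \<in> labels \<Longrightarrow> v j = cis (\<beta> j)" "j \<in> labels \<Longrightarrow> v (nxt j) = cis (\<beta> (j + 1))"
  using assms by (auto simp: angle_lift_def)

lemma angles: "\<exists>\<beta>. angle_lift \<beta>"
proof -
  obtain \<alpha> :: "nat \<Rightarrow> real" where a: "strict_mono_on labels \<alpha>" "\<alpha> k < \<alpha> 1 + 2 * pi"
    "\<And>j. j \<in> labels \<Longrightarrow> v j = cis (\<alpha> j)"
    using vertices by (auto simp: ideal_polygon_vertices_def)
  define \<beta> where "\<beta> j = (if j \<le> k then \<alpha> j else \<alpha> 1 + 2 * pi)" for j
  show ?thesis
    unfolding angle_lift_def
  proof (intro exI[of _ \<beta>] conjI ballI)
    show "strict_mono_on {1..k+1} \<beta>"
    proof (rule strict_mono_onI)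
      fix r s assume rs: "r \<in> {1..k+1}" "s \<in> {1..k+1}" "r < s"
      then have r: "\<beta> r = \<alpha> r" "r \<in> labels" by (auto simp: \<beta>_def)
      show "\<beta> r < \<beta> s"
      proof (cases "s \<le> k")
        case True
        then show ?thesis using a(1) rs r by (auto simp: \<beta>_def strict_mono_on_def)
      next
        case False
        have "\<alpha> r \<le> \<alpha> k" using a(1) r(2) three_le
          by (cases "r = k") (auto simp: strict_mono_on_def less_imp_le)
        then show ?thesis using False a(2) r by (simp add: \<beta>_def)
      qed
    qed
    show "\<beta> (k + 1) = \<beta> 1 + 2 * pi" using three_le by (simp add: \<beta>_def)
    show "v j = cis (\<beta> j)" if "j \<in> labels" for j using that a(3) by (simp add: \<beta>_def)
    show "v (nxt j) = cis (\<beta> (j + 1))" if "j \<in> labels" for j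
    proof (cases "j = k")
      case True
      have "v (nxt j) = cis (\<alpha> 1)" using True three_le a(3) by (simp add: next_label_def)
      then show ?thesis using True by (simp add: \<beta>_def cis_mult[symmetric])
    next
      case False
      then show ?thesis using a(3)[of "j + 1"] that by (simp add: \<beta>_def next_label_def)
    qed
  qed
qed

lemma angle_in_range:
  assumes "cmod z = 1"
  obtains t where "a \<le> t" "t < a + 2 * pi" "z = cis t"
proof -
  define m where "m = floor ((Arg z - a) / (2 * pi))"
  define t where "t = Arg z - 2 * pi * of_int m"
  have "of_int m \<le> (Arg z - a) / (2 * pi)" "(Arg z - a) / (2 * pi) < of_int m + 1"
    unfolding m_def by linarith+
  then have "a \<le> t" "t < a + 2 * pi" unfolding t_def by (simp_all add: field_simps)
  moreover have "cis t = z"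
  proof -
    have "cis t = cis (Arg z) / cis (2 * pi * of_int m)" unfolding t_def cis_divide ..
    also have "cis (2 * pi * of_int m) = 1" by (simp add: cis_multiple_2pi)
    finally show ?thesis using assms cis_Arg[of z] unit_nonzero[OF assms] by (simp add: sgn_eq)
  qed
  ultimately show ?thesis using that by metis
qed

lemma side_fun_cis:
  assumes B: "angle_lift \<beta>"
    and j: "j \<in> labels" and t: "\<beta> 1 \<le> t" "t < \<beta> 1 + 2 * pi"
  shows "side_fun j (cis t) < 0 \<longleftrightarrow> \<beta> j < t \<and> t < \<beta> (j + 1)"
proof -
  note b = angle_liftD[OF B]
  have le: "\<beta> r \<le> \<beta> s" if "r \<in> {1..k+1}" "s \<in> {1..k+1}" "r \<le> s" for r s
    using b(1) that by (cases "r = s") (auto simp: strict_mono_on_def less_imp_le)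
  have lt: "\<beta> r < \<beta> s" if "r \<in> {1..k+1}" "s \<in> {1..k+1}" "r < s" for r s
    using b(1) that by (auto simp: strict_mono_on_def)
  have 1: "\<beta> 1 \<le> \<beta> j" "\<beta> j < \<beta> (j + 1)" "\<beta> (j + 1) \<le> \<beta> 1 + 2 * pi"
    using le[of 1 j] lt[of j "j+1"] le[of "j+1" "k+1"] j b(2) by auto
  \<comment> \<open>No side spans the whole turn, as there are at least three of them.\<close>
  have 2: "\<beta> 1 < \<beta> j \<or> \<beta> (j + 1) < \<beta> 1 + 2 * pi"
    using lt[of 1 j] lt[of "j+1" "k+1"] j b(2) three_le by (cases "j = 1") auto
  have s1: "sin ((\<beta> (j + 1) - \<beta> j) / 2) > 0"
    using sin_half_sign(1)[of "\<beta> (j + 1) - \<beta> j"] 1 2 by linarith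
  have s2: "sin ((t - \<beta> j) / 2) > 0 \<longleftrightarrow> \<beta> j < t" "sin ((t - \<beta> j) / 2) < 0 \<longleftrightarrow> t < \<beta> j"
    using sin_half_sign[of "t - \<beta> j"] 1 t by auto
  have s3: "(sin ((t - \<beta> (j + 1)) / 2) > 0 \<longleftrightarrow> \<beta> (j + 1) < t)"
      "(sin ((t - \<beta> (j + 1)) / 2) < 0 \<longleftrightarrow> t < \<beta> (j + 1))" if "\<not> (\<beta> (j + 1) = \<beta> 1 + 2 * pi \<and> t = \<beta> 1)"
    using sin_half_sign[of "t - \<beta> (j + 1)"] 1 t that by auto
  have "side_fun j (cis t) = 4 * sin ((\<beta> (j + 1) - \<beta> j) / 2) * sin ((t - \<beta> (j + 1)) / 2) * sin ((t - \<beta> j) / 2)"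
    unfolding side_fun_def b(3)[OF j] b(4)[OF j] orient_cis ..
  then have "side_fun j (cis t) < 0 \<longleftrightarrow> sin ((t - \<beta> (j + 1)) / 2) * sin ((t - \<beta> j) / 2) < 0"
    using s1 by (simp add: mult_less_0_iff zero_less_mult_iff)
  also have "\<dots> \<longleftrightarrow> \<beta> j < t \<and> t < \<beta> (j + 1)"
  \<comment> \<open>Only for the last side and \<open>t = \<beta> 1\<close> does the difference
    reach \<open>- 2 * pi\<close>, the end of the range of \<open>sin_half_sign\<close>. The point
    is then the vertex \<open>v 1\<close>, an end of that side.\<close>
  proof (cases "\<beta> (j + 1) = \<beta> 1 + 2 * pi \<and> t = \<beta> 1")
    case True
    then have "(t - \<beta> (j + 1)) / 2 = - pi" by simp
    then show ?thesis using True 1 by simp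
  next
    case False
    show ?thesis unfolding mult_less_0_iff s3[OF False] s2 using 1 by linarith
  qed
  finally show ?thesis .
qed

lemma v_inj: "i \<in> labels \<Longrightarrow> j \<in> labels \<Longrightarrow> v i = v j \<Longrightarrow> i = j"
proof -
  have *: False if "i \<in> labels" "j \<in> labels" "v i = v j" "i < j" for i j
  proof -
    obtain \<beta> where B: "angle_lift \<beta>" using angles by blast
    note b = angle_liftD[OF B]
    have lt: "\<beta> r < \<beta> s" if "r \<in> {1..k+1}" "s \<in> {1..k+1}" "r < s" for r s
      using b(1) that by (auto simp: strict_mono_on_def)
    have "\<beta> 1 \<le> \<beta> i" using lt[of 1 i] that by (cases "i = 1") auto
    then have x: "0 < \<beta> j - \<beta> i" "\<beta> j - \<beta> i < 2 * pi"
      using lt[of i j] lt[of j "k + 1"] that b(2) by auto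
    have "cis (\<beta> j - \<beta> i) = v j / v i"
      by (simp only: b(3)[OF that(1)] b(3)[OF that(2)] cis_divide)
    also have "\<dots> = 1" using that(3) unit_nonzero[OF norm_v[OF that(1)]] by simp
    finally have "cos (\<beta> j - \<beta> i) = 1" by (metis cis.sel(1) one_complex.sel(1))
    moreover have "cos (\<beta> j - \<beta> i) = 1 - 2 * (sin ((\<beta> j - \<beta> i) / 2))\<^sup>2"
      using cos_double_sin[of "(\<beta> j - \<beta> i) / 2"] by (simp only: nonzero_mult_div_cancel_left times_divide_eq_right)
    moreover have "sin ((\<beta> j - \<beta> i) / 2) > 0" using x sin_half_sign(1)[of "\<beta> j - \<beta> i"] by auto
    ultimately show False by simp
  qed
  show "i \<in> labels \<Longrightarrow> j \<in> labels \<Longrightarrow> v i = v j \<Longrightarrow> i = j"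
    using *[of i j] *[of j i] by (cases i j rule: linorder_cases) auto
qed

lemma v_neq: "j \<in> labels \<Longrightarrow> v j \<noteq> v (nxt j)"
  using v_inj[of j "nxt j"] nxt_in[of j] nxt_neq[of j] by auto

section \<open>Sign patterns of the side functions\<close>

lemmas side_assms = norm_v norm_v[OF nxt_in] v_neq

lemma side_fun_eq_0_iff:
  "j \<in> labels \<Longrightarrow> cmod z = 1 \<Longrightarrow> side_fun j z = 0 \<longleftrightarrow> z = v j \<or> z = v (nxt j)"
  unfolding side_fun_def by (simp add: orient_eq_0_iff side_assms)

text \<open>No \<open>\<beta> i\<close> lies strictly between two consecutive ones, so no vertex
  lies beyond a side.\<close>

lemma side_fun_vertex_nonneg: "i \<in> labels \<Longrightarrow> j \<in> labels \<Longrightarrow> 0 \<le> side_fun j (v i)"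
proof -
  assume ij: "i \<in> labels" "j \<in> labels"
  obtain \<beta> where B: "angle_lift \<beta>" using angles by blast
    note b = angle_liftD[OF B]
  have le: "\<beta> r < \<beta> s \<longleftrightarrow> r < s" if "r \<in> {1..k+1}" "s \<in> {1..k+1}" for r s
    using strict_mono_on_less[OF b(1)] that by auto
  have "\<beta> 1 \<le> \<beta> i" "\<beta> i < \<beta> 1 + 2 * pi"
    using le[of i 1] le[of i "k + 1"] ij b(2) by auto
  then have "side_fun j (v i) < 0 \<longleftrightarrow> \<beta> j < \<beta> i \<and> \<beta> i < \<beta> (j + 1)"
    unfolding b(3)[OF ij(1)] using side_fun_cis[OF B ij(2)] by blast
  also have "\<dots> \<longleftrightarrow> False" using le[of j i] le[of i "j + 1"] ij by auto
  finally show ?thesis by auto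
qed

lemma side_fun_vertex_eq_0_iff:
  "i \<in> labels \<Longrightarrow> j \<in> labels \<Longrightarrow> side_fun j (v i) = 0 \<longleftrightarrow> i = j \<or> i = nxt j"
  using side_fun_eq_0_iff[of j "v i"] norm_v[of i] v_inj[of i j] v_inj[of i "nxt j"] nxt_in[of j]
  by auto

lemma verts_not_in_arc: "z \<in> verts \<Longrightarrow> j \<in> labels \<Longrightarrow> z \<notin> arc j"
  using side_fun_vertex_nonneg by (force simp: arc_def)

lemma arcs_cover:
  assumes "cmod z = 1" "z \<notin> verts"
  obtains j where "j \<in> labels" "z \<in> arc j"
proof -
  obtain \<beta> where B: "angle_lift \<beta>" using angles by blast
    note b = angle_liftD[OF B]
  obtain t where t: "\<beta> 1 \<le> t" "t < \<beta> 1 + 2 * pi" "z = cis t"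
    using angle_in_range[OF assms(1)] .
  define S where "S = {j \<in> labels. \<beta> j \<le> t}"
  have S: "finite S" "S \<noteq> {}" using t three_le by (auto simp: S_def intro!: exI[of _ 1])
  define j where "j = Max S"
  have j: "j \<in> labels" "\<beta> j \<le> t" using Max_in[OF S] by (auto simp: S_def j_def)
  have "t < \<beta> (j + 1)"
  proof (cases "j = k")
    case True
    then show ?thesis using t b(2) by simp
  next
    case False
    then have "j + 1 \<notin> S" using Max_ge[OF S(1), of "j + 1"] by (auto simp: j_def)
    then show ?thesis using False j by (auto simp: S_def)
  qed
  moreover have "t \<noteq> \<beta> j" using assms(2) t(3) b(3)[OF j(1)] imageI[OF j(1), of v] by auto
  ultimately have "side_fun j z < 0" using side_fun_cis[OF B j(1) t(1,2)] j(2) t(3) by auto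
  then show ?thesis using that j assms by (simp add: arc_def)
qed

lemma arc_side_fun_pos:
  assumes "z \<in> arc i" "i \<in> labels" "j \<in> labels" "i \<noteq> j"
  shows "0 < side_fun j z"
proof (rule ccontr)
  assume "\<not> 0 < side_fun j z"
  moreover have z: "cmod z = 1" using assms by (simp add: arc_def)
  moreover have "side_fun j z \<noteq> 0"
    using side_fun_eq_0_iff[OF assms(3) z] verts_not_in_arc[OF _ assms(2)] assms(1,3) nxt_in by blast
  ultimately have neg: "side_fun j z < 0" by auto
  obtain \<beta> where B: "angle_lift \<beta>" using angles by blast
    note b = angle_liftD[OF B]
  obtain t where t: "\<beta> 1 \<le> t" "t < \<beta> 1 + 2 * pi" "z = cis t"
    using angle_in_range[OF z] .
  have "\<beta> j < t" "t < \<beta> (j + 1)" "\<beta> i < t" "t < \<beta> (i + 1)"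
    using side_fun_cis[OF B _ t(1,2)] neg assms t(3) by (auto simp: arc_def)
  then have "\<beta> j < \<beta> (i + 1)" "\<beta> i < \<beta> (j + 1)" by linarith+
  moreover have le: "\<beta> r < \<beta> s \<longleftrightarrow> r < s" if "r \<in> {1..k+1}" "s \<in> {1..k+1}" for r s
    using strict_mono_on_less[OF b(1)] that by auto
  ultimately show False using assms by auto
qed

lemma arc_disjoint: "z \<in> arc i \<Longrightarrow> z \<in> arc j \<Longrightarrow> i \<in> labels \<Longrightarrow> j \<in> labels \<Longrightarrow> i = j"
  using arc_side_fun_pos by (force simp: arc_def)

lemma closed_arc_cases:
  "z \<in> closed_arc j \<Longrightarrow> j \<in> labels \<Longrightarrow> z \<in> arc j \<or> z = v j \<or> z = v (nxt j)"
  using side_fun_eq_0_iff[of j z] by (force simp: closed_arc_def arc_def)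

lemma arc_closed_arc: "z \<in> arc j \<Longrightarrow> z \<in> closed_arc j"
  by (auto simp: closed_arc_def arc_def)

lemma closed_arc_vertex: "i \<in> labels \<Longrightarrow> j \<in> labels \<Longrightarrow> v i \<in> closed_arc j \<longleftrightarrow> i = j \<or> i = nxt j"
  using side_fun_vertex_eq_0_iff[of i j] side_fun_vertex_nonneg[of i j] norm_v[of i]
  by (auto simp: closed_arc_def)

lemma closed_arc_side_fun_nonneg:
  assumes "z \<in> closed_arc i" "i \<in> labels" "j \<in> labels" "i \<noteq> j"
  shows "0 \<le> side_fun j z"
  using closed_arc_cases[OF assms(1,2)] arc_side_fun_pos[OF _ assms(2-4)]
    side_fun_vertex_nonneg nxt_in assms by (auto simp: less_imp_le)

lemma norm_side_refl: "j \<in> labels \<Longrightarrow> cmod z = 1 \<Longrightarrow> cmod (side_refl j z) = 1"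
  unfolding side_refl_def by (simp add: norm_reflect_pt side_assms)

lemma side_refl_side_refl: "j \<in> labels \<Longrightarrow> cmod z = 1 \<Longrightarrow> side_refl j (side_refl j z) = z"
  unfolding side_refl_def by (simp add: reflect_pt_reflect_pt side_assms)

lemma side_refl_endpoints: "j \<in> labels \<Longrightarrow> side_refl j (v j) = v j"
    "j \<in> labels \<Longrightarrow> side_refl j (v (nxt j)) = v (nxt j)"
  unfolding side_refl_def by (simp_all add: reflect_pt_endpoints v_neq)

lemma side_fun_side_refl:
  assumes "j \<in> labels" "cmod z = 1"
  shows "side_fun j (side_refl j z) < 0 \<longleftrightarrow> side_fun j z > 0"
    "side_fun j (side_refl j z) > 0 \<longleftrightarrow> side_fun j z < 0"
proof -
  let ?d = "(cmod (2 * z - (v j + v (nxt j))))\<^sup>2" and ?e = "(cmod (v j - v (nxt j)))\<^sup>2"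
  have "side_fun j (side_refl j z) * ?d = - (?e * side_fun j z)"
    unfolding side_fun_def side_refl_def by (intro orient_reflect_pt side_assms assms)
  moreover have "?d > 0"
    using reflect_pt_denominator_nonzero[OF side_assms[OF assms(1)]] assms by auto
  moreover have "?e > 0" using v_neq assms by auto
  ultimately have "side_fun j (side_refl j z) = (- (?e / ?d)) * side_fun j z"
    by (simp add: field_simps)
  moreover have "- (?e / ?d) < 0" using \<open>?d > 0\<close> \<open>?e > 0\<close> by simp
  ultimately show "side_fun j (side_refl j z) < 0 \<longleftrightarrow> side_fun j z > 0"
    "side_fun j (side_refl j z) > 0 \<longleftrightarrow> side_fun j z < 0"
    by (auto simp only: mult_less_0_iff zero_less_mult_iff)
qed

end

section \<open>Bounces\<close>

text \<open>The affine coordinate along the chord in the Klein model, from 0 at the start to 1 at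
  the end: the weight \<open>A / (A + B)\<close> of \<open>klein_geodesic\<close>.\<close>

definition chord_weight :: "complex \<Rightarrow> complex \<Rightarrow> real \<Rightarrow> real" where
  "chord_weight p w t = (1 + tanh (t / 2))\<^sup>2 * (cmod (1 + cnj p * w))\<^sup>2 /
     ((1 + tanh (t / 2))\<^sup>2 * (cmod (1 + cnj p * w))\<^sup>2 + (1 - tanh (t / 2))\<^sup>2 * (cmod (1 - cnj p * w))\<^sup>2)"

lemma chord_weight_bounds:
  assumes "cmod p < 1" "cmod w = 1"
  shows "0 < chord_weight p w t" "chord_weight p w t < 1"
  using klein_geodesic(1,2)[OF assms, of t] by (auto simp: chord_weight_def)

lemma orient_klein_geodesic:
  assumes "passes p w e"
  shows "orient a b (klein (geodesic p w t))
    = (1 - chord_weight p w t) * orient a b (fst e) + chord_weight p w t * orient a b (snd e)"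
  using assms klein_geodesic(3)[of p w t]
  unfolding passes_iff chord_weight_def by (simp add: orient_affine)

lemma isCont_chord_weight:
  assumes "cmod p < 1" "cmod w = 1"
  shows "isCont (chord_weight p w) t"
proof -
  have "cosh (t / 2) \<noteq> 0" using cosh_real_pos[of "t/2"] by linarith
  then show ?thesis
    unfolding chord_weight_def[abs_def]
    using klein_geodesic(1,2)[OF assms, of t] by (intro continuous_intros) auto
qed

text \<open>The ratio \<open>A / B\<close> of the two weights is a constant times
  \<open>exp (2 * t)\<close>; the proof compares it by cross-multiplication.\<close>

lemma chord_weight_mono:
  assumes "cmod p < 1" "cmod w = 1" "s < t"
  shows "chord_weight p w s < chord_weight p w t"
proof -
  define a b where "a = (cmod (1 + cnj p * w))\<^sup>2" and "b = (cmod (1 - cnj p * w))\<^sup>2"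
  have ab: "a > 0" "b > 0"
    using one_plus_cnj_mult_nonzero[of p w] one_plus_cnj_mult_nonzero[of p "-w"] assms
    by (auto simp: a_def b_def)
  define x y where "x = tanh (s / 2)" and "y = tanh (t / 2)"
  have xy: "x < y" "\<bar>x\<bar> < 1" "\<bar>y\<bar> < 1"
    using assms(3) tanh_real_lt_1 tanh_real_gt_neg1 by (auto simp: x_def y_def abs_less_iff minus_less_iff)
  then have lt: "((1 + x) * (1 - y))\<^sup>2 < ((1 + y) * (1 - x))\<^sup>2"
    by (intro power_strict_mono mult_nonneg_nonneg mult_strict_mono) auto
  let ?A = "\<lambda>u. (1 + u)\<^sup>2 * a" and ?B = "\<lambda>u. (1 - u)\<^sup>2 * b"
  have pos: "?A x + ?B x > 0" "?A y + ?B y > 0" using xy ab by (auto intro!: add_pos_pos)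
  have "?A x * ?B y < ?A y * ?B x"
    using mult_strict_left_mono[OF lt, of "a * b"] ab by (simp add: power_mult_distrib mult_ac)
  then have "?A x / (?A x + ?B x) < ?A y / (?A y + ?B y)"
    using pos by (simp add: divide_less_eq less_divide_eq) (simp add: algebra_simps)
  then show ?thesis unfolding chord_weight_def x_def y_def a_def b_def .
qed

text \<open>The law of reflection at \<open>p\<close> becomes a boundary map that no longer mentions
  \<open>p\<close>: the previous formula for directions is applied to both \<open>w\<close> and
  \<open>- w\<close>.\<close>

lemma Moebius_reflect_passes:
  assumes "passes p s (a, b)" "passes p w e" "passes p (reflect_dir s w) e'"
  shows "e' = (reflect_pt a b (fst e), reflect_pt a b (snd e))"
proof -
  have p: "cmod p < 1" and s: "cmod s = 1" and w: "cmod w = 1" and nw: "cmod (- w) = 1"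
    using assms by (auto simp: passes_iff)
  have "reflect_dir s (- w) = - reflect_dir s w" by (simp add: reflect_dir_def)
  then show ?thesis
    using assms reflect_pt_Moebius[OF p s w] reflect_pt_Moebius[OF p s nw]
    by (simp add: passes_iff prod_eq_iff)
qed

context ideal_polygon
begin

lemma in_polygon_iff:
  "z \<in> polygon k v \<longleftrightarrow> (\<forall>j\<in>labels. cmod z < 1 \<and> 0 \<le> side_fun j (klein z))"
  unfolding polygon_def side_def side_fun_def by (auto simp: left_halfplane_iff side_assms)

text \<open>At a point of side \<open>j\<close> every other side function is a proper convex
  combination of its values at the two ends. These are nonnegative and not both 0, because among at
  least three sides no two share both ends.\<close>

lemma side_fun_on_side:
  assumes "j \<in> labels" "passes p s (side k v j)"
  shows "side_fun j (klein p) = 0"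
    and "i \<in> labels \<Longrightarrow> i \<noteq> j \<Longrightarrow> 0 < side_fun i (klein p)"
proof -
  let ?\<mu> = "chord_weight p s 0"
  have mu: "0 < ?\<mu>" "?\<mu> < 1" using chord_weight_bounds assms(2) by (auto simp: passes_iff)
  have eq: "side_fun i (klein p) = (1 - ?\<mu>) * side_fun i (v j) + ?\<mu> * side_fun i (v (nxt j))" for i
    using orient_klein_geodesic[OF assms(2), of _ _ 0] by (simp add: side_fun_def side_def)
  show "side_fun j (klein p) = 0" unfolding eq by (simp add: side_fun_def)
  show "0 < side_fun i (klein p)" if "i \<in> labels" "i \<noteq> j"
  proof -
    have nn: "0 \<le> side_fun i (v j)" "0 \<le> side_fun i (v (nxt j))"
      using side_fun_vertex_nonneg nxt_in that assms by auto
    have "j = nxt i \<Longrightarrow> nxt j \<noteq> i \<and> nxt j \<noteq> nxt i"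
      using nxt_nxt_neq[of i] nxt_neq[of "nxt i"] nxt_in[of i] that by auto
    then have "side_fun i (v j) \<noteq> 0 \<or> side_fun i (v (nxt j)) \<noteq> 0"
      using side_fun_vertex_eq_0_iff[of j i] side_fun_vertex_eq_0_iff[of "nxt j" i]
        nxt_in[of j] that assms(1) by auto
    then show ?thesis
      unfolding eq using nn mu
      by (metis add_nonneg_pos add_pos_nonneg diff_gt_0_iff_gt less_eq_real_def mult_nonneg_nonneg mult_pos_pos)
  qed
qed

text \<open>Along the chord the function of side \<open>j\<close> is affine, 0 at the impact and
  nonnegative just before it, so it does not increase. As neither intercept is a vertex, its end
  values are nonzero, hence positive at the start and negative at the end.\<close>

lemma bounceD:
  assumes "bounce k v e e'" and nv: "fst e \<notin> verts" "snd e \<notin> verts"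
  obtains j where "j \<in> labels" "snd e \<in> arc j" "cmod (fst e) = 1" "0 < side_fun j (fst e)"
    "e' = (side_refl j (fst e), side_refl j (snd e))"
proof -
  obtain j p w s where j: "j \<in> labels" and ps: "passes p s (side k v j)" and pw: "passes p w e"
    and pr: "passes p (reflect_dir s w) e'"
    and ev: "\<forall>\<^sub>F t in at_left 0. geodesic p w t \<in> polygon k v"
    using assms(1) unfolding bounce_def by blast
  have p: "cmod p < 1" "cmod w = 1" using pw by (auto simp: passes_iff)
  have n: "cmod (fst e) = 1" "cmod (snd e) = 1"
    using pw norm_Moebius_unit[of "-p"] p by (auto simp: passes_iff)
  let ?T = "side_fun j (fst e)" and ?P = "side_fun j (snd e)" and ?\<mu> = "chord_weight p w"
  have f: "side_fun j (klein (geodesic p w t)) = (1 - ?\<mu> t) * ?T + ?\<mu> t * ?P" for t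
    using orient_klein_geodesic[OF pw] by (simp add: side_fun_def)
  have z: "(1 - ?\<mu> 0) * ?T + ?\<mu> 0 * ?P = 0"
    using f[of 0] side_fun_on_side(1)[OF j ps] by simp
  have "\<forall>\<^sub>F t in at_left (0::real). t < 0" by (simp add: eventually_at_filter)
  with ev have "\<forall>\<^sub>F t in at_left 0. geodesic p w t \<in> polygon k v \<and> t < 0" by eventually_elim simp
  \<comment> \<open>One moment before the impact is enough, since the function is affine in a
    strictly increasing weight.\<close>
  then obtain t where t: "geodesic p w t \<in> polygon k v" "t < 0"
    using eventually_happens'[OF trivial_limit_at_left_real] by blast
  have "0 \<le> (1 - ?\<mu> t) * ?T + ?\<mu> t * ?P"
    using t(1) j unfolding in_polygon_iff f[symmetric] by blast
  then have "(?\<mu> 0 - ?\<mu> t) * (?T - ?P) \<ge> 0" using z by (simp add: algebra_simps)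
  moreover have "?\<mu> 0 - ?\<mu> t > 0" using chord_weight_mono[OF p t(2)] by simp
  ultimately have le: "?P \<le> ?T" by (simp add: zero_le_mult_iff)
  have nz: "?T \<noteq> 0" "?P \<noteq> 0"
    using side_fun_eq_0_iff[OF j] n nv j nxt_in[OF j] by auto
  have mu: "0 < ?\<mu> 0" "?\<mu> 0 < 1" using chord_weight_bounds[OF p] by auto
  have T: "0 < ?T"
  proof (rule ccontr)
    assume "\<not> 0 < ?T"
    then have "?T < 0" "?P < 0" using nz le by auto
    then have "(1 - ?\<mu> 0) * ?T < 0" "?\<mu> 0 * ?P < 0" using mu by (auto simp: mult_less_0_iff)
    then show False using z by simp
  qed
  moreover have "?P < 0"
  proof (rule ccontr)
    assume "\<not> ?P < 0"
    then have "0 < (1 - ?\<mu> 0) * ?T" "0 \<le> ?\<mu> 0 * ?P" using mu T by auto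
    then show False using z by simp
  qed
  moreover have "e' = (side_refl j (fst e), side_refl j (snd e))"
    using Moebius_reflect_passes[OF ps[unfolded side_def] pw pr] by (simp add: side_refl_def)
  ultimately show ?thesis using that[of j] j n by (simp add: arc_def)
qed

lemma chord_crosses_side:
  assumes j: "j \<in> labels" and n: "cmod a = 1" "cmod b = 1" and s: "0 < side_fun j a" "side_fun j b < 0"
  obtains p w u where "passes p w (a, b)" "passes p u (side k v j)"
proof -
  have ab: "a \<noteq> b" using s by auto
  \<comment> \<open>The weight at which the side function, affine along the chord, vanishes.\<close>
  define \<mu> where "\<mu> = side_fun j a / (side_fun j a - side_fun j b)"
  have mu: "0 < \<mu>" "\<mu> < 1" using s by (simp_all add: \<mu>_def)
  define x where "x = (1 - \<mu>) *\<^sub>R a + \<mu> *\<^sub>R b"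
  have "x \<in> open_segment a b" using ab mu by (auto simp: x_def in_segment)
  then have "cmod x < 1"
    using dist_decreases_open_segment[of x a b 0] n by auto
  then obtain p where p: "cmod p < 1" "klein p = x" using klein_surj by metis
  have 1: "orient a b (klein p) = 0" unfolding p x_def orient_affine by simp
  have "(1 - \<mu>) * side_fun j a + \<mu> * side_fun j b = 0"
    using s by (simp add: \<mu>_def field_simps)
  then have 2: "orient (v j) (v (nxt j)) (klein p) = 0"
    unfolding p x_def orient_affine by (simp add: side_fun_def)
  have "passes p (Moebius_function 0 p b') (a', b')"
    if "cmod a' = 1" "cmod b' = 1" "a' \<noteq> b'" "orient a' b' (klein p) = 0" for a' b'
    using Moebius_antipodal[OF that(1-3) p(1) that(4)] Moebius_inverse[OF p(1)] that
      norm_Moebius_unit[OF p(1)] p(1) by (auto simp: passes_iff) (metis order_refl)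
  from this[OF n ab 1] this[OF side_assms[OF j] 2]
  show ?thesis using that by (simp add: side_def)
qed

text \<open>At the impact all other side functions are positive, hence also nearby. Only side
  \<open>j\<close> needs a sign argument, and the increasing weight supplies it before the impact
  and, for the reflected chord, after it.\<close>

lemma bounceI:
  assumes j: "j \<in> labels" and arc: "snd e \<in> arc j" and n: "cmod (fst e) = 1" "0 < side_fun j (fst e)"
  shows "bounce k v e (side_refl j (fst e), side_refl j (snd e))"
proof -
  have n2: "cmod (snd e) = 1" "side_fun j (snd e) < 0" using arc by (auto simp: arc_def)
  obtain p w s where pw: "passes p w e" and ps: "passes p s (side k v j)"
    using chord_crosses_side[OF j n(1) n2(1) n(2) n2(2)] by auto
  let ?e = "(side_refl j (fst e), side_refl j (snd e))" and ?w = "reflect_dir s w"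
  have p: "cmod p < 1" "cmod w = 1" and w: "cmod ?w = 1"
    using pw ps by (auto simp: passes_iff reflect_dir_def norm_mult norm_power)
  have pr: "passes p ?w ?e"
    using Moebius_reflect_passes[OF ps[unfolded side_def] pw,
      of "(Moebius_function 0 (- p) (- ?w), Moebius_function 0 (- p) ?w)"] p w
    by (simp add: passes_iff side_refl_def)
  have others: "\<forall>\<^sub>F t in at 0. 0 < side_fun i (klein (geodesic p u t))"
    if "passes p u f" "i \<in> labels" "i \<noteq> j" for i u f
  proof -
    have pu: "cmod p < 1" "cmod u = 1" using that by (auto simp: passes_iff)
    let ?f = "\<lambda>t. side_fun i (klein (geodesic p u t))"
    have "isCont ?f 0"
      unfolding side_fun_def orient_klein_geodesic[OF that(1)]
      by (intro continuous_intros isCont_chord_weight pu)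
    then have "(?f \<longlongrightarrow> ?f 0) (at 0)" by (simp add: isCont_def)
    moreover have "?f 0 > 0" using side_fun_on_side(2)[OF j ps that(2,3)] by simp
    ultimately show ?thesis by (rule order_tendstoD)
  qed
  have poly: "\<forall>\<^sub>F t in at 0 within S. geodesic p u t \<in> polygon k v"
    if pu: "passes p u f" and S: "\<And>t. t \<in> S \<Longrightarrow> 0 \<le> side_fun j (klein (geodesic p u t))" for u f S
  proof -
    have pu': "cmod p < 1" "cmod u = 1" using pu by (auto simp: passes_iff)
    have "\<forall>\<^sub>F t in at 0 within S. \<forall>i\<in>labels - {j}. 0 < side_fun i (klein (geodesic p u t))"
      using filter_leD[OF at_le[OF subset_UNIV] others[OF pu]] by (intro eventually_ball_finite) auto
    moreover have "\<forall>\<^sub>F t in at 0 within S. t \<in> S" by (simp add: eventually_at_filter)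
    ultimately show ?thesis
    proof eventually_elim
      case (elim t)
      then show ?case
        using S[of t] klein_geodesic(4)[OF pu'] by (fastforce simp: in_polygon_iff intro: less_imp_le)
    qed
  qed
  have sgn: "side_fun j (klein (geodesic p u t))
      = (chord_weight p u t - chord_weight p u 0) * (side_fun j (snd f) - side_fun j (fst f))"
    if "passes p u f" for u f t
    using orient_klein_geodesic[OF that, of "v j" "v (nxt j)"] side_fun_on_side(1)[OF j ps]
      orient_klein_geodesic[OF that, of "v j" "v (nxt j)" 0]
    by (simp add: side_fun_def algebra_simps)
  have before: "0 \<le> side_fun j (klein (geodesic p w t))" if "t \<in> {..<0}" for t
    unfolding sgn[OF pw] using chord_weight_mono[OF p, of t 0] n n2 that
    by (intro mult_nonpos_nonpos) auto
  have r: "side_fun j (fst ?e) < 0" "0 < side_fun j (snd ?e)"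
    using side_fun_side_refl[OF j] n n2 by auto
  have after: "0 \<le> side_fun j (klein (geodesic p ?w t))" if "t \<in> {0<..}" for t
    unfolding sgn[OF pr] using chord_weight_mono[OF p(1) w, of 0 t] r that
    by (intro mult_nonneg_nonneg) auto
  show ?thesis
    unfolding bounce_def
    using j ps pw pr poly[OF pw before] poly[OF pr after] by blast
qed

end

section \<open>Contraction\<close>

lemma continuous_on_orient [continuous_intros]:
  "continuous_on S f \<Longrightarrow> continuous_on S (\<lambda>z. orient a b (f z))"
  unfolding orient_def by (intro continuous_intros)

context ideal_polygon
begin

text \<open>For unit \<open>z\<close> each summand is - 2 times the Lorentz product of the
  light-like vectors over \<open>z\<close> and \<open>v i\<close>. So \<open>gap\<close> comes from
  the product with the sum of the vertex vectors, and \<open>1 / gap z\<close> is, up to a constant,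
  the density at \<open>z\<close> of the visual metric from their barycentre.\<close>

definition gap :: "complex \<Rightarrow> real" where
  "gap z = (\<Sum>i\<in>labels. (cmod (z - v i))\<^sup>2)"

text \<open>An explicit positive lower bound for \<open>gap\<close>: no point is close to both
  \<open>v 1\<close> and \<open>v 2\<close>.\<close>

definition gap_inf :: real where
  "gap_inf = (cmod (v 1 - v 2))\<^sup>2 / 2"

text \<open>The constant that arises when \<open>reflect_pt_dist\<close> is summed over the vertices
  and the coefficient of \<open>gap z\<close> is scaled to 1.\<close>

definition contr_coeff :: "nat \<Rightarrow> real" where
  "contr_coeff j = 16 * (\<Sum>i\<in>labels. side_fun j (v i)) / ((cmod (v j - v (nxt j)))\<^sup>2)\<^sup>2"

text \<open>The size of the derivative at \<open>z\<close> of the reflection in side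
  \<open>j\<close>, measured in the metric with density \<open>1 / gap\<close>.\<close>

definition contr :: "nat \<Rightarrow> complex \<Rightarrow> real" where
  "contr j z = 1 / (1 + contr_coeff j * side_fun j z / gap z)"

text \<open>Up to a constant factor this is the square of the chordal distance as seen from the point of the
  polygon that is the hyperboloid-model barycentre of the vertices. The Euclidean distance, seen from
  the centre of the disc, would not do: the centre need not lie in the polygon.\<close>

definition pdist :: "complex \<Rightarrow> complex \<Rightarrow> real" where
  "pdist z w = (cmod (z - w))\<^sup>2 / (gap z * gap w)"

section \<open>The visual metric and its change under reflections\<close>

lemma gap_inf_pos: "0 < gap_inf"
  using v_inj[of 1 2] three_le by (auto simp: gap_inf_def)

lemma gap_inf_le: "gap_inf \<le> gap z"
proof -
  let ?x = "cmod (z - v 1)" and ?y = "cmod (z - v 2)"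
  have "cmod (v 1 - v 2) \<le> ?x + ?y"
    using norm_triangle_ineq4[of "z - v 2" "z - v 1"] by simp
  then have "(cmod (v 1 - v 2))\<^sup>2 \<le> (?x + ?y)\<^sup>2" by (intro power_mono) auto
  also have "\<dots> \<le> 2 * (?x\<^sup>2 + ?y\<^sup>2)"
    using sum_squares_bound[of ?x ?y] by (simp add: power2_sum)
  also have "?x\<^sup>2 + ?y\<^sup>2 = (\<Sum>i\<in>{1, 2}. (cmod (z - v i))\<^sup>2)" by simp
  also have "\<dots> \<le> gap z" unfolding gap_def using three_le by (intro sum_mono2) auto
  finally show ?thesis by (simp add: gap_inf_def)
qed

lemma gap_pos: "0 < gap z"
  using gap_inf_pos gap_inf_le[of z] by linarith

lemma gap_le:
  assumes "cmod z = 1"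
  shows "gap z \<le> 4 * real k"
proof -
  have "(cmod (z - v i))\<^sup>2 \<le> 2\<^sup>2" if "i \<in> labels" for i
    using norm_triangle_ineq4[of z "v i"] assms norm_v[OF that] by (intro power_mono) auto
  then have "gap z \<le> (\<Sum>i\<in>labels. 2\<^sup>2)" unfolding gap_def by (intro sum_mono)
  then show ?thesis by simp
qed

text \<open>The sum has a positive term: the vertex following side \<open>j\<close> is not one of
  its ends.\<close>

lemma contr_coeff_pos: "j \<in> labels \<Longrightarrow> 0 < contr_coeff j"
proof -
  assume j: "j \<in> labels"
  let ?i = "nxt (nxt j)"
  have i: "?i \<in> labels" using nxt_in j by blast
  have "side_fun j (v ?i) \<noteq> 0"
    using side_fun_vertex_eq_0_iff[OF i j] nxt_nxt_neq[OF j] nxt_neq[OF nxt_in[OF j]] by auto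
  then have "0 < side_fun j (v ?i)" using side_fun_vertex_nonneg[OF i j] by auto
  then have "0 < (\<Sum>i\<in>labels. side_fun j (v i))"
    using side_fun_vertex_nonneg j by (intro sum_pos2[OF _ i]) auto
  then show ?thesis using v_neq[OF j] by (simp add: contr_coeff_def)
qed

lemma contr_denominator:
  assumes "j \<in> labels" "0 \<le> side_fun j z"
  shows "1 \<le> 1 + contr_coeff j * side_fun j z / gap z"
  using contr_coeff_pos[OF assms(1)] assms(2) gap_pos[of z] by simp

lemma contr_bounds:
  assumes "j \<in> labels" "0 \<le> side_fun j z"
  shows "0 < contr j z" "contr j z \<le> 1"
  unfolding contr_def using contr_denominator[OF assms] by auto

lemma contr_less_1:
  assumes "j \<in> labels" "0 < side_fun j z"
  shows "contr j z < 1"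
proof -
  have "0 < contr_coeff j * side_fun j z / gap z"
    using contr_coeff_pos[OF assms(1)] assms(2) gap_pos[of z] by simp
  then show ?thesis unfolding contr_def by simp
qed

text \<open>\<open>reflect_pt_dist\<close> summed over all vertices; this closed form is the reason
  for building the base point from them.\<close>

lemma gap_side_refl:
  assumes j: "j \<in> labels" and z: "cmod z = 1"
  shows "(cmod (2 * z - (v j + v (nxt j))))\<^sup>2 * gap (side_refl j z)
    = (cmod (v j - v (nxt j)))\<^sup>2 * (gap z + contr_coeff j * side_fun j z)"
proof -
  let ?l = "(cmod (2 * z - (v j + v (nxt j))))\<^sup>2" and ?m = "(cmod (v j - v (nxt j)))\<^sup>2"
  have m: "?m \<noteq> 0" using v_neq[OF j] by simp
  have "?l * gap (side_refl j z) * ?m = (\<Sum>i\<in>labels. ?l * (cmod (side_refl j z - v i))\<^sup>2 * ?m)"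
    unfolding gap_def by (simp only: sum_distrib_left sum_distrib_right)
  also have "\<dots> = (\<Sum>i\<in>labels. ?m\<^sup>2 * (cmod (z - v i))\<^sup>2 + 16 * side_fun j z * side_fun j (v i))"
    unfolding side_refl_def side_fun_def
    by (intro sum.cong refl reflect_pt_dist side_assms j z norm_v)
  also have "\<dots> = ?m\<^sup>2 * gap z + 16 * side_fun j z * (\<Sum>i\<in>labels. side_fun j (v i))"
    unfolding gap_def by (simp only: sum.distrib sum_distrib_left)
  also have "\<dots> = ?m * (gap z + contr_coeff j * side_fun j z) * ?m"
    unfolding contr_coeff_def using m by (simp add: field_simps power2_eq_square)
  finally show ?thesis using m by simp
qed

text \<open>A Moebius map multiplies the squared chordal distance by its derivatives at both points,
  and passing to the density \<open>1 / gap\<close> keeps this form.\<close>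

lemma pdist_side_refl:
  assumes j: "j \<in> labels" and z: "cmod z = 1" "0 \<le> side_fun j z" and w: "cmod w = 1" "0 \<le> side_fun j w"
  shows "pdist (side_refl j z) (side_refl j w) = contr j z * contr j w * pdist z w"
proof -
  let ?l = "\<lambda>z. (cmod (2 * z - (v j + v (nxt j))))\<^sup>2" and ?m = "(cmod (v j - v (nxt j)))\<^sup>2"
  let ?q = "\<lambda>z. 1 + contr_coeff j * side_fun j z / gap z"
  have m: "?m > 0" using v_neq[OF j] by simp
  have l: "?l z > 0" "?l w > 0"
    using reflect_pt_denominator_nonzero[OF side_assms[OF j]] z w by auto
  have q: "?q z > 0" "?q w > 0" using contr_denominator[OF j] z w by (auto intro: less_le_trans[OF zero_less_one])
  have g: "gap (side_refl j u) = ?m * gap u * ?q u / ?l u" if "cmod u = 1" "?l u > 0" for u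
    using gap_side_refl[OF j that(1)] that(2) gap_pos[of u] by (simp add: field_simps)
  have "cmod (side_refl j z - side_refl j w) = ?m * cmod (z - w) / (cmod (2 * z - (v j + v (nxt j))) * cmod (2 * w - (v j + v (nxt j))))"
    unfolding side_refl_def reflect_pt_diff[OF side_assms[OF j] z(1) w(1)]
    by (simp add: norm_mult norm_divide norm_power)
  then have d: "(cmod (side_refl j z - side_refl j w))\<^sup>2 = ?m\<^sup>2 * (cmod (z - w))\<^sup>2 / (?l z * ?l w)"
    by (simp add: power_divide power_mult_distrib)
  have gen: "m\<^sup>2 * x / (lz * lw) / (m * gz * qz / lz * (m * gw * qw / lw)) = 1 / qz * (1 / qw) * (x / (gz * gw))"
    if "m > 0" "lz > 0" "lw > 0" for m x lz lw gz gw qz qw :: real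
    using that by (simp add: power2_eq_square)
  show ?thesis
    unfolding pdist_def contr_def d g[OF z(1) l(1)] g[OF w(1) l(2)]
    by (rule gen[OF m l])
qed

lemma pdist_nonneg: "0 \<le> pdist z w"
  unfolding pdist_def using gap_pos[of z] gap_pos[of w] by simp

lemma pdist_le: "cmod z = 1 \<Longrightarrow> cmod w = 1 \<Longrightarrow> pdist z w \<le> 4 / gap_inf\<^sup>2"
proof -
  assume n: "cmod z = 1" "cmod w = 1"
  have "(cmod (z - w))\<^sup>2 \<le> 2\<^sup>2"
    using norm_triangle_ineq4[of z w] n by (intro power_mono) auto
  moreover have "gap_inf * gap_inf \<le> gap z * gap w"
    using gap_inf_le gap_inf_pos by (intro mult_mono) (auto intro: less_imp_le gap_pos)
  ultimately show ?thesis
    unfolding pdist_def power2_eq_square[of gap_inf] using gap_inf_pos by (intro frac_le) auto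
qed

text \<open>On the circle \<open>gap\<close> lies between \<open>gap_inf\<close> and
  \<open>4 * real k\<close>, so \<open>pdist\<close> is comparable to the squared Euclidean
  distance; this is the lower half.\<close>

lemma pdist_ge: "cmod z = 1 \<Longrightarrow> cmod w = 1 \<Longrightarrow> (cmod (z - w))\<^sup>2 / (4 * real k)\<^sup>2 \<le> pdist z w"
  unfolding pdist_def power2_eq_square[of "4 * real k"]
  using gap_le gap_pos three_le by (intro divide_left_mono mult_mono mult_pos_pos) (auto intro: less_imp_le)

lemma dist_ge_pdist: "gap_inf\<^sup>2 * pdist z w \<le> (cmod (z - w))\<^sup>2"
proof -
  have "gap_inf * gap_inf \<le> gap z * gap w"
    using gap_inf_le gap_inf_pos by (intro mult_mono) (auto intro: less_imp_le gap_pos)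
  then have "gap_inf\<^sup>2 * pdist z w \<le> (gap z * gap w) * pdist z w"
    unfolding power2_eq_square by (intro mult_right_mono pdist_nonneg)
  also have "\<dots> = (cmod (z - w))\<^sup>2"
    using gap_pos[of z] gap_pos[of w] by (simp add: pdist_def)
  finally show ?thesis .
qed

section \<open>Uniform contraction by compactness, and shrinking of cylinders\<close>

lemma continuous_on_side_fun [continuous_intros]:
  "continuous_on S f \<Longrightarrow> continuous_on S (\<lambda>z. side_fun j (f z))"
  unfolding side_fun_def by (intro continuous_intros)

lemma continuous_on_gap [continuous_intros]:
  "continuous_on S f \<Longrightarrow> continuous_on S (\<lambda>z. gap (f z))"
  unfolding gap_def by (intro continuous_intros)

lemma continuous_on_side_refl:
  assumes "j \<in> labels"
  shows "continuous_on (sphere 0 1) (side_refl j)"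
proof -
  have "2 * z - (v j + v (nxt j)) \<noteq> 0" if "z \<in> sphere 0 1" for z
    using reflect_pt_denominator_nonzero[OF side_assms[OF assms]] that by simp
  then show ?thesis
    unfolding side_refl_def[abs_def] reflect_pt_def by (intro continuous_intros) auto
qed

lemma compact_closed_arc: "compact (closed_arc j)"
proof -
  have "closed {z. side_fun j z \<le> 0}" by (intro closed_Collect_le continuous_intros)
  then have "compact (sphere 0 1 \<inter> {z. side_fun j z \<le> 0})" by (intro compact_Int_closed) auto
  also have "sphere 0 1 \<inter> {z. side_fun j z \<le> 0} = closed_arc j" by (auto simp: closed_arc_def)
  finally show ?thesis .
qed

lemma closed_arc_norm: "z \<in> closed_arc j \<Longrightarrow> cmod z = 1"
  by (simp add: closed_arc_def)

text \<open>The zeros are the two ends of side \<open>j\<close>. If both were on the closed arc of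
  \<open>i\<close>, then \<open>i\<close> would both precede and follow \<open>j\<close>, which
  needs a polygon with only two sides.\<close>

lemma closed_arc_side_fun_zero_unique:
  assumes ij: "i \<in> labels" "j \<in> labels" "i \<noteq> j" and zw: "z \<in> closed_arc i" "w \<in> closed_arc i"
    and 0: "side_fun j z = 0" "side_fun j w = 0"
  shows "z = w"
proof -
  have *: "u = v j \<and> j = nxt i \<or> u = v (nxt j) \<and> nxt j = i" if "u \<in> closed_arc i" "side_fun j u = 0" for u
  proof -
    have "u = v j \<or> u = v (nxt j)"
      using side_fun_eq_0_iff[OF ij(2) closed_arc_norm[OF that(1)]] that(2) by simp
    then show ?thesis
      using closed_arc_vertex[OF ij(2,1)] closed_arc_vertex[OF nxt_in[OF ij(2)] ij(1)] that(1) ij nxt_inj[of i j]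
      by auto
  qed
  show ?thesis using *[OF zw(1) 0(1)] *[OF zw(2) 0(2)] nxt_nxt_neq[OF ij(1)] by auto
qed

text \<open>Two different points are not both zeros of the side function, so one of the two factors
  is below 1. The pairs at distance at least \<open>\<epsilon>\<close> form a compact set, on which
  the product attains its maximum.\<close>

lemma contraction_pair:
  assumes ij: "i \<in> labels" "j \<in> labels" "i \<noteq> j" and eps: "0 < \<epsilon>"
  shows "\<exists>c<1. \<forall>z\<in>closed_arc i. \<forall>w\<in>closed_arc i. \<epsilon> \<le> cmod (z - w) \<longrightarrow> contr j z * contr j w \<le> c"
proof -
  let ?K = "(closed_arc i \<times> closed_arc i) \<inter> {x. \<epsilon> \<le> cmod (fst x - snd x)}"
  let ?f = "\<lambda>x. contr j (fst x) * contr j (snd x)"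
  have K: "compact ?K"
    by (intro compact_Int_closed compact_Times compact_closed_arc closed_Collect_le continuous_intros)
  have nn: "0 \<le> side_fun j z" if "z \<in> closed_arc i" for z
    using closed_arc_side_fun_nonneg[OF that ij] .
  have "1 + contr_coeff j * side_fun j z / gap z \<noteq> 0" "gap z \<noteq> 0" if "z \<in> closed_arc i" for z
    using contr_denominator[OF ij(2) nn[OF that]] gap_pos[of z] by auto
  then have f: "continuous_on ?K ?f"
    unfolding contr_def by (intro continuous_intros) auto
  have lt: "?f x < 1" if "x \<in> ?K" for x
  proof -
    obtain z w where x1: "x = (z, w)" by (cases x)
    with that have x: "x = (z, w)" "z \<in> closed_arc i" "w \<in> closed_arc i" "\<epsilon> \<le> cmod (z - w)"
      by auto
    from x(4) have "z \<noteq> w" using eps by auto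
    then have "side_fun j z \<noteq> 0 \<or> side_fun j w \<noteq> 0"
      using closed_arc_side_fun_zero_unique[OF ij x(2,3)] by auto
    then have "contr j z < 1 \<or> contr j w < 1"
      using nn x contr_less_1[OF ij(2)] by (metis less_eq_real_def)
    moreover have b: "0 < contr j z" "contr j z \<le> 1" "0 < contr j w" "contr j w \<le> 1"
      using contr_bounds[OF ij(2)] nn x by auto
    moreover have "contr j z * contr j w \<le> contr j z" "contr j z * contr j w \<le> contr j w"
      using b by (auto intro: mult_right_le_one_le mult_left_le_one_le)
    ultimately show ?thesis unfolding x(1) fst_conv snd_conv by linarith
  qed
  show ?thesis
  proof (cases "?K = {}")
    case True
    then show ?thesis by (intro exI[of _ 0]) force
  next
    case False
    obtain x where x: "x \<in> ?K" "\<forall>y\<in>?K. ?f y \<le> ?f x"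
      using continuous_attains_sup[OF K False f] by blast
    show ?thesis
    proof (intro exI[of _ "?f x"] conjI ballI impI)
      show "?f x < 1" using lt[OF x(1)] .
      fix z w assume "z \<in> closed_arc i" "w \<in> closed_arc i" "\<epsilon> \<le> cmod (z - w)"
      then show "contr j z * contr j w \<le> ?f x" using x(2)[rule_format, of "(z, w)"] by auto
    qed
  qed
qed

lemma uniform_contraction:
  assumes "0 < \<epsilon>"
  obtains c where "0 \<le> c" "c < 1"
    "\<And>i j z w. i \<in> labels \<Longrightarrow> j \<in> labels \<Longrightarrow> i \<noteq> j \<Longrightarrow> z \<in> closed_arc i \<Longrightarrow> w \<in> closed_arc i \<Longrightarrow>
       \<epsilon> \<le> cmod (z - w) \<Longrightarrow> pdist (side_refl j z) (side_refl j w) \<le> c * pdist z w"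
proof -
  let ?I = "{(i, j). i \<in> labels \<and> j \<in> labels \<and> i \<noteq> j}"
  have "\<forall>p\<in>?I. \<exists>c<1. \<forall>z\<in>closed_arc (fst p). \<forall>w\<in>closed_arc (fst p).
      \<epsilon> \<le> cmod (z - w) \<longrightarrow> contr (snd p) z * contr (snd p) w \<le> c"
    using contraction_pair assms by auto
  then obtain c where c: "\<forall>p\<in>?I. c p < 1 \<and> (\<forall>z\<in>closed_arc (fst p). \<forall>w\<in>closed_arc (fst p).
      \<epsilon> \<le> cmod (z - w) \<longrightarrow> contr (snd p) z * contr (snd p) w \<le> c p)"
    by (rule bchoice[THEN exE]) blast
  have fin: "finite (insert 0 (c ` ?I))"
    by (intro finite.insertI finite_imageI finite_subset[of ?I "labels \<times> labels"]) auto
  \<comment> \<open>0 is included to make the factor, and later its powers, nonnegative.\<close>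
  define m where "m = Max (insert 0 (c ` ?I))"
  show ?thesis
  proof (rule that[of m])
    show "0 \<le> m" unfolding m_def using fin by (intro Max_ge) auto
    show "m < 1" unfolding m_def using fin c by (subst Max_less_iff) auto
    fix i j z w
    assume ij: "i \<in> labels" "j \<in> labels" "i \<noteq> j" and zw: "z \<in> closed_arc i" "w \<in> closed_arc i" "\<epsilon> \<le> cmod (z - w)"
    have "contr j z * contr j w \<le> c (i, j)" using c ij zw by fastforce
    also have "\<dots> \<le> m" unfolding m_def using fin ij by (intro Max_ge) auto
    finally show "pdist (side_refl j z) (side_refl j w) \<le> m * pdist z w"
      using pdist_side_refl[of j z w] closed_arc_side_fun_nonneg[of _ i j] closed_arc_norm ij zw
        mult_right_mono[OF _ pdist_nonneg] by simp
  qed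
qed

text \<open>A finite orbit segment, written as a relation over closed arcs so that it may sit at an
  ideal vertex, where no label is determined. It has \<open>N + 1\<close> labels, and
  \<open>z 0\<close> is the image of \<open>z N\<close> under \<open>N\<close> reflections.\<close>

definition refl_chain :: "nat \<Rightarrow> (nat \<Rightarrow> nat) \<Rightarrow> (nat \<Rightarrow> complex) \<Rightarrow> bool" where
  "refl_chain N x z \<longleftrightarrow> (\<forall>n\<le>N. z n \<in> closed_arc (x n)) \<and> (\<forall>n<N. z n = side_refl (x n) (z (Suc n)))"

definition label_seq :: "(nat \<Rightarrow> nat) \<Rightarrow> bool" where
  "label_seq x \<longleftrightarrow> (\<forall>n. x n \<in> labels \<and> x n \<noteq> x (Suc n))"

lemma label_seqD:
  assumes "label_seq x"
  shows "x n \<in> labels" "x n \<noteq> x (Suc n)"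
  using assms by (auto simp: label_seq_def)

text \<open>If \<open>z 0\<close> and \<open>w 0\<close> were far apart, so would be all later
  pairs, whose \<open>pdist\<close> is at least as large. The uniform factor then applies at each of
  the \<open>N\<close> steps and brings the bounded \<open>pdist\<close> below the assumed one. The
  choice of \<open>N\<close> depends on \<open>\<epsilon>\<close> alone, not on the labels.\<close>

lemma cylinders_shrink:
  assumes eps: "0 < \<epsilon>"
  shows "\<exists>N. \<forall>x z w. label_seq x \<longrightarrow> refl_chain N x z \<longrightarrow> refl_chain N x w \<longrightarrow> cmod (z 0 - w 0) < \<epsilon>"
proof -
  \<comment> \<open>A lower bound for \<open>pdist\<close> at Euclidean distance at least
    \<open>\<epsilon>\<close>, from \<open>pdist_ge\<close>.\<close>
  define \<delta> where "\<delta> = \<epsilon>\<^sup>2 / (4 * real k)\<^sup>2"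
  have d: "0 < \<delta>" using eps three_le by (simp add: \<delta>_def)
  \<comment> \<open>By \<open>dist_ge_pdist\<close>, points with \<open>pdist\<close> at least
    \<open>\<delta>\<close> have Euclidean distance at least \<open>\<epsilon>'\<close>.\<close>
  define \<epsilon>' where "\<epsilon>' = gap_inf * sqrt \<delta>"
  have e': "0 < \<epsilon>'" using d gap_inf_pos by (simp add: \<epsilon>'_def)
  obtain c where c: "0 \<le> c" "c < 1" and contr:
    "\<And>i j z w. i \<in> labels \<Longrightarrow> j \<in> labels \<Longrightarrow> i \<noteq> j \<Longrightarrow> z \<in> closed_arc i \<Longrightarrow> w \<in> closed_arc i \<Longrightarrow>
       \<epsilon>' \<le> cmod (z - w) \<Longrightarrow> pdist (side_refl j z) (side_refl j w) \<le> c * pdist z w"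
    using uniform_contraction[OF e'] by blast
  have "(\<lambda>N. c ^ N * (4 / gap_inf\<^sup>2)) \<longlonglongrightarrow> 0 * (4 / gap_inf\<^sup>2)"
    by (intro tendsto_mult_right LIMSEQ_realpow_zero c)
  then have "\<forall>\<^sub>F N in sequentially. c ^ N * (4 / gap_inf\<^sup>2) < \<delta>"
    using d by (intro order_tendstoD) auto
  then obtain N where N: "c ^ N * (4 / gap_inf\<^sup>2) < \<delta>"
    using eventually_happens'[OF trivial_limit_sequentially] by blast
  show ?thesis
  proof (intro exI[of _ N] allI impI, rule ccontr)
    fix x z w
    assume x': "label_seq x"
      and z: "refl_chain N x z" and w: "refl_chain N x w" and far: "\<not> cmod (z 0 - w 0) < \<epsilon>"
    note x = label_seqD[OF x']
    have n: "cmod (z n) = 1" "cmod (w n) = 1" if "n \<le> N" for n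
      using z w that closed_arc_norm by (auto simp: refl_chain_def)
    have "\<delta> \<le> (cmod (z 0 - w 0))\<^sup>2 / (4 * real k)\<^sup>2"
      unfolding \<delta>_def using far eps by (intro divide_right_mono power_mono) auto
    also have "\<dots> \<le> pdist (z 0) (w 0)" using n by (intro pdist_ge) auto
    finally have d0: "\<delta> \<le> pdist (z 0) (w 0)" .
    have step: "pdist (z n) (w n) \<le> c * pdist (z (Suc n)) (w (Suc n))"
      if "n < N" "\<delta> \<le> pdist (z (Suc n)) (w (Suc n))" for n
    proof -
      have "\<epsilon>'\<^sup>2 = gap_inf\<^sup>2 * \<delta>" using d by (simp add: \<epsilon>'_def power_mult_distrib)
      also have "\<dots> \<le> gap_inf\<^sup>2 * pdist (z (Suc n)) (w (Suc n))" using that(2) by (intro mult_left_mono) auto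
      also have "\<dots> \<le> (cmod (z (Suc n) - w (Suc n)))\<^sup>2" by (rule dist_ge_pdist)
      finally have "\<epsilon>' \<le> cmod (z (Suc n) - w (Suc n))" by (rule power2_le_imp_le) simp
      from contr[OF x(1)[of "Suc n"] x(1)[of n] x(2)[symmetric] _ _ this] show ?thesis
        using z w that by (auto simp: refl_chain_def)
    qed
    have mono: "pdist (z n) (w n) \<le> pdist (z (Suc n)) (w (Suc n))" if "n < N" for n
    proof -
      let ?j = "x n" and ?z = "z (Suc n)" and ?w = "w (Suc n)"
      have a: "?z \<in> closed_arc (x (Suc n))" "?w \<in> closed_arc (x (Suc n))"
        and b: "z n = side_refl ?j ?z" "w n = side_refl ?j ?w"
        using z w that by (auto simp: refl_chain_def)
      have nn: "0 \<le> side_fun ?j ?z" "0 \<le> side_fun ?j ?w"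
        using closed_arc_side_fun_nonneg[OF _ x(1) x(1) x(2)[symmetric]] a by auto
      have "pdist (z n) (w n) = contr ?j ?z * contr ?j ?w * pdist ?z ?w"
        unfolding b using a nn closed_arc_norm by (intro pdist_side_refl x) auto
      also have "\<dots> \<le> 1 * pdist ?z ?w"
        using contr_bounds[OF x(1) nn(1)] contr_bounds[OF x(1) nn(2)]
        by (intro mult_right_mono pdist_nonneg mult_le_one) auto
      finally show ?thesis by simp
    qed
    have "\<delta> \<le> pdist (z n) (w n) \<and> pdist (z 0) (w 0) \<le> c ^ n * pdist (z n) (w n)" if "n \<le> N" for n
      using that
    proof (induction n)
      case 0
      then show ?case using d0 by simp
    next
      case (Suc n)
      then have IH: "\<delta> \<le> pdist (z n) (w n)" "pdist (z 0) (w 0) \<le> c ^ n * pdist (z n) (w n)" by auto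
      have 1: "\<delta> \<le> pdist (z (Suc n)) (w (Suc n))" using IH(1) mono[of n] Suc.prems by auto
      have "c ^ n * pdist (z n) (w n) \<le> c ^ n * (c * pdist (z (Suc n)) (w (Suc n)))"
        using step[of n] Suc.prems 1 c by (intro mult_left_mono) auto
      then show ?case using 1 IH(2) by (simp add: mult_ac)
    qed
    from this[of N] have "pdist (z 0) (w 0) \<le> c ^ N * pdist (z N) (w N)" by simp
    also have "\<dots> \<le> c ^ N * (4 / gap_inf\<^sup>2)"
      using n c by (intro mult_left_mono pdist_le) auto
    finally show False using N d0 by linarith
  qed
qed

end

section \<open>One-sided coding\<close>

context ideal_polygon
begin

definition lab :: "complex \<Rightarrow> nat" where
  "lab z = (THE j. j \<in> labels \<and> z \<in> arc j)"

definition bd_map :: "complex \<Rightarrow> complex" where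
  "bd_map z = side_refl (lab z) z"

text \<open>A vertex is caught at the first visit, so the arbitrary value of \<open>lab\<close> at
  vertices does not influence which points are regular.\<close>

definition regular :: "complex \<Rightarrow> bool" where
  "regular z \<longleftrightarrow> cmod z = 1 \<and> (\<forall>n. (bd_map ^^ n) z \<notin> verts)"

definition code :: "complex \<Rightarrow> nat \<Rightarrow> nat" where
  "code z n = lab ((bd_map ^^ n) z)"

text \<open>The one-sided form of the rules, for the future of a trajectory and for its past read
  backwards. Fixing the parity loses nothing, as adjacency is symmetric.\<close>

definition admissible :: "(nat \<Rightarrow> nat) \<Rightarrow> bool" where
  "admissible y \<longleftrightarrow> label_seq y \<and>
     (\<forall>a\<in>labels. \<forall>b\<in>labels. adjacent k a b \<longrightarrow>
        (\<forall>N. \<exists>n\<ge>N. y n \<noteq> (if even n then a else b)))"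

section \<open>Orbits of the boundary map and their codes\<close>

lemma lab_eq: "z \<in> arc j \<Longrightarrow> j \<in> labels \<Longrightarrow> lab z = j"
  unfolding lab_def using arc_disjoint by blast

lemma lab_props:
  assumes "cmod z = 1" "z \<notin> verts"
  shows "lab z \<in> labels" "z \<in> arc (lab z)"
proof -
  obtain j where "j \<in> labels" "z \<in> arc j" using arcs_cover[OF assms] .
  then show "lab z \<in> labels" "z \<in> arc (lab z)" using lab_eq by auto
qed

lemma regular_norm: "regular z \<Longrightarrow> cmod z = 1"
  by (simp add: regular_def)

lemma regular_lab:
  assumes "regular z"
  shows "lab z \<in> labels" "z \<in> arc (lab z)"
proof -
  have "z \<notin> verts" using assms unfolding regular_def by (metis funpow_0)
  then show "lab z \<in> labels" "z \<in> arc (lab z)" using lab_props assms by (auto simp: regular_def)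
qed

text \<open>The reflection moves the point out of the arc it was in, which forces a new label at the
  next step.\<close>

lemma regular_bd_map:
  assumes "regular z"
  shows "regular (bd_map z)" "lab (bd_map z) \<noteq> lab z" "side_refl (lab z) (bd_map z) = z"
proof -
  have "(bd_map ^^ n) (bd_map z) = (bd_map ^^ Suc n) z" for n
    by (simp add: funpow_swap1)
  then show r: "regular (bd_map z)"
    using assms regular_lab[OF assms] unfolding regular_def
    by (auto simp: bd_map_def norm_side_refl simp del: funpow.simps)
  have "0 < side_fun (lab z) (bd_map z)"
    using side_fun_side_refl(2)[OF regular_lab(1)[OF assms] regular_norm[OF assms]]
      regular_lab(2)[OF assms] by (auto simp: bd_map_def arc_def)
  then show "lab (bd_map z) \<noteq> lab z"
    using regular_lab(2)[OF r] by (auto simp: arc_def)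
  show "side_refl (lab z) (bd_map z) = z"
    unfolding bd_map_def by (rule side_refl_side_refl[OF regular_lab(1)[OF assms] regular_norm[OF assms]])
qed

text \<open>The reflections are the inverse branches of \<open>bd_map\<close>: that of side
  \<open>j\<close> puts \<open>j\<close> in front of the code.\<close>

lemma regular_side_refl:
  assumes "regular z" "j \<in> labels" "lab z \<noteq> j"
  shows "regular (side_refl j z)" "lab (side_refl j z) = j" "bd_map (side_refl j z) = z"
proof -
  have n: "cmod z = 1" using regular_norm[OF assms(1)] .
  have "0 < side_fun j z"
    using arc_side_fun_pos[OF regular_lab(2,1)[OF assms(1)] assms(2,3)] .
  then have arc: "side_refl j z \<in> arc j"
    using side_fun_side_refl(1)[OF assms(2) n] norm_side_refl[OF assms(2) n] by (simp add: arc_def)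
  then show lab: "lab (side_refl j z) = j" using lab_eq assms(2) by simp
  show F: "bd_map (side_refl j z) = z"
    unfolding bd_map_def lab by (rule side_refl_side_refl[OF assms(2) n])
  have "(bd_map ^^ m) (side_refl j z) \<notin> verts" for m
  proof (cases m)
    case 0
    then show ?thesis using verts_not_in_arc arc assms(2) by auto
  next
    case (Suc l)
    then show ?thesis using assms(1) F unfolding regular_def
      by (auto simp: funpow_swap1)
  qed
  then show "regular (side_refl j z)"
    using norm_side_refl[OF assms(2) n] by (simp add: regular_def)
qed

lemma regular_iterate: "regular z \<Longrightarrow> regular ((bd_map ^^ n) z)"
  by (induction n) (auto intro: regular_bd_map)

lemma code_Suc: "code z (Suc n) = code (bd_map z) n"
  by (simp add: code_def funpow_swap1)

lemma regular_code_chain: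
  assumes "regular z"
  shows "refl_chain N (code z) (\<lambda>n. (bd_map ^^ n) z)"
  using regular_iterate[OF assms] regular_lab(2) regular_bd_map(3)
  by (auto simp: refl_chain_def code_def intro!: arc_closed_arc)

lemma code_labels: "regular z \<Longrightarrow> code z n \<in> labels"
  unfolding code_def using regular_iterate regular_lab by blast

lemma code_neq: "regular z \<Longrightarrow> code z n \<noteq> code z (Suc n)"
  unfolding code_def using regular_bd_map(2)[OF regular_iterate, of z n] by simp

lemma label_seq_code: "regular z \<Longrightarrow> label_seq (code z)"
  unfolding label_seq_def using code_labels code_neq by blast

lemma adjacent_common_vertex:
  assumes "a \<in> labels" "b \<in> labels" "adjacent k a b"
  obtains m where "m \<in> labels" "v m \<in> closed_arc a" "v m \<in> closed_arc b"
  using assms that[of a] that[of b] closed_arc_vertex[of a a] closed_arc_vertex[of b b]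
    closed_arc_vertex[of a b] closed_arc_vertex[of b a] unfolding adjacent_def by blast

lemma side_refl_closed_arc_vertex:
  assumes "m \<in> labels" "j \<in> labels" "v m \<in> closed_arc j"
  shows "side_refl j (v m) = v m"
  using closed_arc_vertex[OF assms(1,2)] assms side_refl_endpoints by auto

text \<open>If the itinerary alternates around an ideal vertex, the constant sequence at that vertex is
  another chain with the same itinerary, so the cylinders shrink to the vertex.\<close>

lemma admissible_code:
  assumes z: "regular z"
  shows "admissible (code z)"
  unfolding admissible_def
proof (intro conjI allI ballI impI)
  show "label_seq (code z)" by (rule label_seq_code[OF z])
next
  fix a b N assume ab: "a \<in> labels" "b \<in> labels" "adjacent k a b"
  show "\<exists>n\<ge>N. code z n \<noteq> (if even n then a else b)"
  proof (rule ccontr)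
    assume "\<not> ?thesis"
    then have alt: "code z n = (if even n then a else b)" if "n \<ge> N" for n using that by blast
    obtain m where m: "m \<in> labels" "v m \<in> closed_arc a" "v m \<in> closed_arc b"
      using adjacent_common_vertex[OF ab] .
    let ?z = "(bd_map ^^ N) z"
    have reg: "regular ?z" by (rule regular_iterate[OF z])
    have "code ?z n = code z (n + N)" for n by (simp add: code_def funpow_add)
    then have cab: "code ?z n = a \<or> code ?z n = b" for n using alt by auto
    have chain: "refl_chain M (code ?z) (\<lambda>_. v m)" for M
      unfolding refl_chain_def
      using cab m(2,3) side_refl_closed_arc_vertex[OF m(1)] ab(1,2) by metis
    have "cmod (?z - v m) < \<epsilon>" if "0 < \<epsilon>" for \<epsilon>
    proof -
      obtain M where M: "label_seq (code ?z) \<longrightarrow> refl_chain M (code ?z) (\<lambda>n. (bd_map ^^ n) ?z)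
          \<longrightarrow> refl_chain M (code ?z) (\<lambda>_. v m) \<longrightarrow> cmod ((bd_map ^^ 0) ?z - v m) < \<epsilon>"
        using cylinders_shrink[OF \<open>0 < \<epsilon>\<close>] by meson
      show ?thesis
        using M[rule_format, OF label_seq_code[OF reg] regular_code_chain[OF reg] chain] by simp
    qed
    from this[of "cmod (?z - v m)"] have "?z = v m" by (cases "?z = v m") simp_all
    then show False using z imageI[OF m(1), of v] unfolding regular_def by metis
  qed
qed

lemma refl_chain_code:
  assumes "regular z" "regular w" "\<And>n. n \<le> N \<Longrightarrow> code z n = code w n"
  shows "refl_chain N (code z) (\<lambda>n. (bd_map ^^ n) w)"
  using regular_code_chain[OF assms(2), of N] assms(3) by (auto simp: refl_chain_def)

text \<open>The orbits of \<open>z\<close> and \<open>w\<close> are chains over the same labels. As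
  \<open>N\<close> serves all pairs, decoding is uniformly continuous.\<close>

lemma code_determines:
  assumes "0 < \<epsilon>"
  shows "\<exists>N. \<forall>z w. regular z \<longrightarrow> regular w \<longrightarrow> (\<forall>n\<le>N. code z n = code w n) \<longrightarrow> cmod (z - w) < \<epsilon>"
proof -
  obtain N where N: "\<forall>x z w. label_seq x \<longrightarrow> refl_chain N x z \<longrightarrow> refl_chain N x w \<longrightarrow> cmod (z 0 - w 0) < \<epsilon>"
    using cylinders_shrink[OF assms] by blast
  show ?thesis
  proof (intro exI[of _ N] allI impI)
    fix z w assume zw: "regular z" "regular w" "\<forall>n\<le>N. code z n = code w n"
    show "cmod (z - w) < \<epsilon>"
      using N[rule_format, OF label_seq_code[OF zw(1)] regular_code_chain[OF zw(1)]
          refl_chain_code[OF zw(1,2) zw(3)[rule_format]]] by simp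
  qed
qed

lemma code_inj:
  assumes "regular z" "regular w" "code z = code w"
  shows "z = w"
proof (rule ccontr)
  assume "z \<noteq> w"
  then have "0 < cmod (z - w)" by simp
  then obtain N where "(\<forall>n\<le>N. code z n = code w n) \<longrightarrow> cmod (z - w) < cmod (z - w)"
    using code_determines assms(1,2) by meson
  then show False using assms(3) by simp
qed

text \<open>The arcs are open in the circle and \<open>bd_map\<close> is continuous on each of them.
  Here the radius depends on the point, since it must keep \<open>w\<close> in the arc of
  \<open>z\<close>.\<close>

lemma code_locally_constant:
  assumes "regular z"
  shows "\<exists>\<delta>>0. \<forall>w. regular w \<longrightarrow> cmod (z - w) < \<delta> \<longrightarrow> (\<forall>n<N. code w n = code z n)"
  using assms
proof (induction N arbitrary: z)
  case 0
  then show ?case by (auto intro: exI[of _ 1])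
next
  case (Suc N)
  let ?j = "lab z"
  have j: "?j \<in> labels" "z \<in> arc ?j" using regular_lab[OF Suc.prems] by auto
  obtain \<delta>1 where d1: "\<delta>1 > 0" "\<And>w. regular w \<Longrightarrow> cmod (bd_map z - w) < \<delta>1 \<Longrightarrow> \<forall>n<N. code w n = code (bd_map z) n"
    using Suc.IH[OF regular_bd_map(1)[OF Suc.prems]] by auto
  have "open {w. side_fun ?j w < 0}" by (intro open_Collect_less continuous_intros)
  moreover have "z \<in> {w. side_fun ?j w < 0}" using j by (simp add: arc_def)
  ultimately obtain \<delta>2 where d2: "\<delta>2 > 0" "\<And>w. dist w z < \<delta>2 \<Longrightarrow> side_fun ?j w < 0"
    unfolding open_dist by auto
  have "z \<in> sphere 0 1" using regular_norm[OF Suc.prems] by simp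
  then obtain \<delta>3 where d3: "\<delta>3 > 0"
      "\<And>w. w \<in> sphere 0 1 \<Longrightarrow> dist w z < \<delta>3 \<Longrightarrow> dist (side_refl ?j w) (side_refl ?j z) < \<delta>1"
    using continuous_on_side_refl[OF j(1)] d1(1) unfolding continuous_on_iff by metis
  show ?case
  proof (intro exI[of _ "min \<delta>2 \<delta>3"] conjI allI impI)
    show "0 < min \<delta>2 \<delta>3" using d2 d3 by simp
    fix w n assume w: "regular w" "cmod (z - w) < min \<delta>2 \<delta>3" and n: "n < Suc N"
    have dist: "dist w z < \<delta>2" "dist w z < \<delta>3"
      using w(2) by (auto simp: dist_norm norm_minus_commute)
    have "w \<in> arc ?j" using d2(2)[OF dist(1)] regular_norm[OF w(1)] by (simp add: arc_def)
    then have lab: "lab w = ?j" by (rule lab_eq[OF _ j(1)])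
    have "dist (bd_map w) (bd_map z) < \<delta>1"
      using d3(2)[OF _ dist(2)] regular_norm[OF w(1)] by (simp add: bd_map_def lab)
    then have "\<forall>n<N. code (bd_map w) n = code (bd_map z) n"
      using d1(2)[OF regular_bd_map(1)[OF w(1)]] by (simp add: dist_norm norm_minus_commute)
    then show "code w n = code z n"
      using n lab by (cases n) (auto simp: code_Suc code_def[of _ 0])
  qed
qed

section \<open>Points with a prescribed code\<close>

lemma label_seq_Suc: "label_seq y \<Longrightarrow> label_seq (\<lambda>m. y (Suc m))"
  by (simp add: label_seq_def)

text \<open>Level \<open>n\<close> constrains \<open>n + 1\<close> labels. Recursion on the front
  label makes each level the image of a compact set under one reflection.\<close>

primrec cylinder :: "nat \<Rightarrow> (nat \<Rightarrow> nat) \<Rightarrow> complex set" where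
  "cylinder 0 y = closed_arc (y 0)"
| "cylinder (Suc n) y = side_refl (y 0) ` cylinder n (\<lambda>m. y (Suc m))"

lemma side_refl_closed_arc:
  assumes "i \<in> labels" "j \<in> labels" "i \<noteq> j" "z \<in> closed_arc i"
  shows "side_refl j z \<in> closed_arc j"
  using side_fun_side_refl(2)[OF assms(2) closed_arc_norm[OF assms(4)]]
    closed_arc_side_fun_nonneg[OF assms(4,1,2,3)]
    norm_side_refl[OF assms(2) closed_arc_norm[OF assms(4)]]
  by (auto simp: closed_arc_def)

lemma cylinder_antimono:
  assumes "label_seq y"
  shows "cylinder (Suc n) y \<subseteq> cylinder n y"
  using assms
proof (induction n arbitrary: y)
  case 0
  then show ?case
    using side_refl_closed_arc[of "y (Suc 0)" "y 0"] label_seqD[OF 0, of 0] label_seqD(1)[OF 0, of "Suc 0"]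
    by auto
next
  case (Suc n)
  show ?case
    using image_mono[OF Suc.IH[OF label_seq_Suc[OF Suc.prems]], of "side_refl (y 0)"] by simp
qed

lemma cylinder_subset:
  assumes "label_seq y"
  shows "cylinder n y \<subseteq> closed_arc (y 0)"
  using lift_Suc_antimono_le[of "\<lambda>n. cylinder n y" 0 n, OF cylinder_antimono[OF assms]] by simp

lemma cylinder_compact_nonempty:
  assumes "label_seq y"
  shows "compact (cylinder n y) \<and> cylinder n y \<noteq> {}"
  using assms
proof (induction n arbitrary: y)
  case 0
  then show ?case
    using compact_closed_arc closed_arc_vertex[of "y 0" "y 0"] label_seqD(1)[OF 0, of 0] by auto
next
  case (Suc n)
  let ?y = "\<lambda>m. y (Suc m)"
  have y: "label_seq ?y" by (rule label_seq_Suc[OF Suc.prems])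
  have "cylinder n ?y \<subseteq> sphere 0 1"
    using cylinder_subset[OF y, of n] closed_arc_norm by auto
  then have "continuous_on (cylinder n ?y) (side_refl (y 0))"
    using continuous_on_subset continuous_on_side_refl[OF label_seqD(1)[OF Suc.prems]] by blast
  then show ?case
    using Suc.IH[OF y] by (simp add: compact_continuous_image)
qed

text \<open>The cylinders are nested nonempty compact sets, so they have a common point. It forces
  the rest of the chain, since reflections are involutions.\<close>

lemma refl_chain_exists:
  assumes y': "label_seq y"
  shows "\<exists>z. \<forall>N. refl_chain N y z"
proof -
  note y = label_seqD[OF y']
  have anti: "m \<le> n \<Longrightarrow> cylinder n y \<subseteq> cylinder m y" for m n
    by (rule lift_Suc_antimono_le[of "\<lambda>n. cylinder n y" m n, OF cylinder_antimono[OF y']])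
  have "\<Inter> (range (\<lambda>n. cylinder n y)) \<noteq> {}"
    using cylinder_compact_nonempty[OF y'] anti by (intro compact_nest) auto
  then obtain z0 where z0: "\<And>n. z0 \<in> cylinder n y" by auto
  define z where "z = rec_nat z0 (\<lambda>n u. side_refl (y n) u)"
  have z: "z 0 = z0" "\<And>n. z (Suc n) = side_refl (y n) (z n)" by (simp_all add: z_def)
  have in_cyl: "z n \<in> cylinder m (\<lambda>i. y (n + i))" for n m
  proof (induction n arbitrary: m)
    case 0
    then show ?case using z0 z by simp
  next
    case (Suc n)
    obtain u where u: "u \<in> cylinder m (\<lambda>i. y (n + Suc i))" "z n = side_refl (y n) u"
      using Suc.IH[of "Suc m"] by auto
    have "cylinder m (\<lambda>i. y (n + Suc i)) \<subseteq> closed_arc (y (n + Suc 0))"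
      by (rule cylinder_subset) (use y' in \<open>simp add: label_seq_def\<close>)
    then have "cmod u = 1" using u(1) closed_arc_norm by blast
    then have "z (Suc n) = u" using z u side_refl_side_refl[OF y(1)] by simp
    then show ?case using u(1) by simp
  qed
  then have arc: "z n \<in> closed_arc (y n)" for n using in_cyl[of n 0] by simp
  have "z n = side_refl (y n) (z (Suc n))" for n
    unfolding z(2) by (rule side_refl_side_refl[OF y(1) closed_arc_norm[OF arc], symmetric])
  then have "refl_chain N y z" for N unfolding refl_chain_def using arc by blast
  then show ?thesis by blast
qed

text \<open>Only the two sides that meet at a vertex have it on their closed arcs.\<close>

lemma labels_at_vertex_unique:
  assumes m: "m \<in> labels" and l: "a \<in> labels" "b \<in> labels" "c \<in> labels"
    and arcs: "v m \<in> closed_arc a" "v m \<in> closed_arc b" "v m \<in> closed_arc c" and ne: "a \<noteq> b" "b \<noteq> c"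
  shows "a = c" "adjacent k a b"
proof -
  have at: "m = a \<or> m = nxt a" "m = b \<or> m = nxt b" "m = c \<or> m = nxt c"
    using closed_arc_vertex[OF m] l arcs by blast+
  have inj: "nxt a = nxt b \<longrightarrow> a = b" "nxt b = nxt c \<longrightarrow> b = c" "nxt a = nxt c \<longrightarrow> a = c"
    using nxt_inj l by blast+
  show "a = c" using at inj ne by metis
  show "adjacent k a b" unfolding adjacent_def using at inj ne by metis
qed

lemma refl_chain_step:
  assumes "label_seq y" "\<And>N. refl_chain N y z"
  shows "z n \<in> closed_arc (y n)" "side_refl (y n) (z n) = z (Suc n)"
proof -
  have za: "z n \<in> closed_arc (y n)" "z n = side_refl (y n) (z (Suc n))" for n
    using assms(2)[of "Suc n"] unfolding refl_chain_def using le_SucI[OF order_refl] lessI by blast+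
  show "z n \<in> closed_arc (y n)" by (rule za(1))
  have "side_refl (y n) (z n) = side_refl (y n) (side_refl (y n) (z (Suc n)))"
    using za(2)[of n] by (rule arg_cong)
  also have "\<dots> = z (Suc n)"
    by (rule side_refl_side_refl[OF label_seqD(1)[OF assms(1)] closed_arc_norm[OF za(1)]])
  finally show "side_refl (y n) (z n) = z (Suc n)" .
qed

text \<open>A chain that reaches an ideal vertex stays there, because every further reflection is in
  a side through this vertex and fixes it. Its labels then alternate between the two sides that meet
  there.\<close>

lemma admissible_chain_not_vertex:
  assumes y: "admissible y" and z: "\<And>N. refl_chain N y z"
  shows "z N \<notin> verts"
proof
  assume "z N \<in> verts"
  then obtain m where m: "m \<in> labels" "z N = v m" by auto
  have ls: "label_seq y" using y by (simp add: admissible_def)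
  note yl = label_seqD[OF ls]
  note za = refl_chain_step[OF ls z]
  have zn: "z n = v m" if "N \<le> n" for n
    using that
  proof (induction n rule: dec_induct)
    case (step n)
    have "z (Suc n) = side_refl (y n) (z n)"
      using za(2) by simp
    also have "\<dots> = v m"
      using step.IH za(1)[of n] side_refl_closed_arc_vertex[OF m(1) yl(1)] by simp
    finally show ?case .
  qed (use m in simp)
  have vm: "y n \<in> labels \<and> v m \<in> closed_arc (y n)" if "N \<le> n" for n
    using zn[OF that] za(1)[of n] yl by simp
  have per: "y (Suc (Suc n)) = y n" if "N \<le> n" for n
    using labels_at_vertex_unique(1)[OF m(1), of "y n" "y (Suc n)" "y (Suc (Suc n))"] that
      vm[of n] vm[of "Suc n"] vm[of "Suc (Suc n)"] yl(2)[of n] yl(2)[of "Suc n"] by simp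
  \<comment> \<open>An even starting index matches the parity convention of
    \<open>admissible\<close>.\<close>
  define M where "M = 2 * N"
  have M: "N \<le> M" "even M" by (simp_all add: M_def)
  have adj: "adjacent k (y M) (y (Suc M))"
    using labels_at_vertex_unique(2)[OF m(1), of "y M" "y (Suc M)" "y M"] M vm[of M] vm[of "Suc M"] yl(2)[of M]
    by simp
  have alt: "y n = (if even n then y M else y (Suc M)) \<and> y (Suc n) = (if even n then y (Suc M) else y M)" if "M \<le> n" for n
    using that
  proof (induction n rule: dec_induct)
    case (step n)
    then show ?case using per[of n] M by auto
  qed (use M in simp)
  have "\<exists>n\<ge>M. y n \<noteq> (if even n then y M else y (Suc M))"
    using y adj yl(1) unfolding admissible_def by blast
  then show False using alt by blast
qed

text \<open>A chain off the vertices runs through open arcs, where its labels are values of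
  \<open>lab\<close>; it is therefore an orbit of \<open>bd_map\<close>.\<close>

lemma code_surj:
  assumes y: "admissible y"
  obtains z where "regular z" "code z = y"
proof -
  have ls: "label_seq y" using y by (simp add: admissible_def)
  note yl = label_seqD[OF ls]
  obtain z where z: "\<And>N. refl_chain N y z" using refl_chain_exists[OF ls] by blast
  note za = refl_chain_step[OF ls z]
  have arc: "z n \<in> arc (y n)" for n
    using closed_arc_cases[OF za(1) yl(1), of n] admissible_chain_not_vertex[OF y z, of n] yl(1)[of n] nxt_in
    by auto
  have lab: "lab (z n) = y n" for n using lab_eq[OF arc yl(1)] .
  have step: "bd_map (z n) = z (Suc n)" for n
    unfolding bd_map_def lab by (rule za(2))
  have it: "(bd_map ^^ n) (z 0) = z n" for n
    by (induction n) (auto simp: step)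
  show ?thesis
  proof (rule that)
    show "regular (z 0)"
      using admissible_chain_not_vertex[OF y z] closed_arc_norm[OF za(1)] by (simp add: regular_def it)
    show "code (z 0) = y" by (rule ext) (simp add: code_def it lab)
  qed
qed

end

section \<open>Two-sided coding\<close>

lemma norm_diff_le_bd_dist:
  assumes "cmod z = 1" "cmod w = 1"
  shows "cmod (z - w) \<le> bd_dist z w"
proof -
  have nz: "w \<noteq> 0" "z / w \<noteq> 0" using assms by auto
  have "cis (Arg (z / w)) = z / w"
    using cis_Arg[OF nz(2)] assms by (simp add: sgn_eq norm_divide)
  then have "cmod (z / w - 1) = 2 * \<bar>sin (Arg (z / w) / 2)\<bar>"
    using dist_exp_i_1[of "Arg (z / w)"] by (simp add: cis_conv_exp dist_norm)
  also have "\<dots> \<le> bd_dist z w"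
    unfolding bd_dist_def using abs_sin_x_le_abs_x[of "Arg (z / w) / 2"] by simp
  also have "z / w - 1 = (z - w) / w" using nz by (simp add: field_simps)
  finally show ?thesis using assms by (simp add: norm_divide)
qed

lemma bd_dist_small:
  assumes "0 < \<epsilon>"
  obtains \<delta> where "0 < \<delta>" "\<And>z w. cmod z = 1 \<Longrightarrow> cmod w = 1 \<Longrightarrow> cmod (z - w) < \<delta> \<Longrightarrow> bd_dist z w < \<epsilon>"
proof -
  have "isCont Arg 1" by (rule continuous_at_Arg) simp
  then obtain \<delta> where d: "0 < \<delta>" "\<And>u. dist u 1 < \<delta> \<Longrightarrow> dist (Arg u) (Arg 1) < \<epsilon>"
    using assms unfolding continuous_at_eps_delta by blast
  show ?thesis
  proof (rule that[OF d(1)])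
    fix z w assume zw: "cmod z = 1" "cmod w = 1" "cmod (z - w) < \<delta>"
    then have "w \<noteq> 0" by auto
    then have "z / w - 1 = (z - w) / w" by (simp add: field_simps)
    then have "dist (z / w) 1 < \<delta>" using zw by (simp add: dist_norm norm_divide)
    then show "bd_dist z w < \<epsilon>" using d(2)[of "z / w"] by (simp add: bd_dist_def dist_norm)
  qed
qed

lemma bd_dist_commute: "bd_dist z w = bd_dist w z"
proof -
  have "\<bar>Arg (inverse x)\<bar> = \<bar>Arg x\<bar>" for x
  proof (cases "x = 0 \<or> Arg x = pi")
    case True
    then show ?thesis using Arg_inverse[of x] by auto
  next
    case False
    then show ?thesis using Arg_inverse[of x] by (auto simp: complex_nonpos_Reals_iff)
  qed
  from this[of "z / w"] show ?thesis by (simp add: bd_dist_def)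
qed

text \<open>If the absolute arguments add up to less than pi, \<open>Arg\<close> is additive;
  otherwise their sum already bounds every value of \<open>Arg\<close>.\<close>

lemma Arg_mult_abs_le:
  assumes "x \<noteq> 0" "y \<noteq> 0"
  shows "\<bar>Arg (x * y)\<bar> \<le> \<bar>Arg x\<bar> + \<bar>Arg y\<bar>"
proof (cases "\<bar>Arg x\<bar> + \<bar>Arg y\<bar> < pi")
  case True
  have "Arg (x * y) = Arg x + Arg y"
  proof (rule cis_Arg_unique)
    show "sgn (x * y) = cis (Arg x + Arg y)"
      using cis_Arg[OF assms(1)] cis_Arg[OF assms(2)] by (simp add: sgn_mult cis_mult[symmetric])
  qed (use True in auto)
  then show ?thesis by simp
next
  case False
  then show ?thesis using mpi_less_Arg[of "x * y"] Arg_le_pi[of "x * y"] by linarith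
qed

lemma bd_dist_triangle:
  assumes "cmod x = 1" "cmod y = 1" "cmod z = 1"
  shows "bd_dist x z \<le> bd_dist x y + bd_dist y z"
proof -
  have nz: "x \<noteq> 0" "y \<noteq> 0" "z \<noteq> 0" using assms by auto
  then have "x / z = (x / y) * (y / z)" by simp
  then show ?thesis using Arg_mult_abs_le[of "x / y" "y / z"] nz by (simp add: bd_dist_def)
qed

lemma bd_dist_nonneg: "0 \<le> bd_dist z w"
  by (simp add: bd_dist_def)

lemma bd_dist_self: "z \<noteq> 0 \<Longrightarrow> bd_dist z z = 0"
  by (simp add: bd_dist_def)

section \<open>The metric on label sequences\<close>

lemma seq_dist_le:
  assumes "\<And>n. \<bar>n\<bar> < int m \<Longrightarrow> x n = y n"
  shows "seq_dist x y \<le> 1 / 2 ^ m"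
  unfolding seq_dist_def using assms by (intro cInf_lower bdd_belowI[of _ 0]) auto

lemma seq_dist_witness:
  assumes "seq_dist x y < c"
  obtains m where "1 / 2 ^ m < c" "\<And>n. \<bar>n\<bar> < int m \<Longrightarrow> x n = y n"
proof -
  let ?S = "{1 / 2 ^ m | m :: nat. \<forall>n. \<bar>n\<bar> < int m \<longrightarrow> x n = y n} :: real set"
  have "?S \<noteq> {}" by (auto intro!: exI[of _ 0])
  then obtain r where "r \<in> ?S" "r < c"
    using assms cInf_lessD[of ?S c] unfolding seq_dist_def by blast
  then show ?thesis using that by auto
qed

text \<open>The inequality is strict, so the exponent that witnesses it exceeds \<open>m\<close>;
  this gives agreement at \<open>m\<close> and \<open>- m\<close> too.\<close>

lemma seq_dist_less_imp_eq: "seq_dist x y < 1 / 2 ^ m \<Longrightarrow> \<bar>n\<bar> \<le> int m \<Longrightarrow> x n = y n"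
proof -
  assume "seq_dist x y < 1 / 2 ^ m" and n: "\<bar>n\<bar> \<le> int m"
  then obtain m' where m': "1 / 2 ^ m' < (1 / 2 ^ m :: real)" "\<And>n. \<bar>n\<bar> < int m' \<Longrightarrow> x n = y n"
    using seq_dist_witness by blast
  then have "(2::real) ^ m < 2 ^ m'" by (simp add: field_simps)
  then have "m < m'" by simp
  then show ?thesis using m'(2) n by auto
qed

lemma seq_dist_nonneg: "0 \<le> seq_dist x y"
proof -
  let ?S = "{1 / 2 ^ m | m :: nat. \<forall>n. \<bar>n\<bar> < int m \<longrightarrow> x n = y n} :: real set"
  have "?S \<noteq> {}" by (auto intro!: exI[of _ 0])
  then show ?thesis unfolding seq_dist_def by (intro cInf_greatest) auto
qed

lemma pow_half_small:
  assumes "0 < (\<epsilon>::real)"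
  obtains m where "1 / 2 ^ m < \<epsilon>"
  using real_arch_pow_inv[OF assms, of "1/2"] by (auto simp: power_divide)

lemma Metric_space_seq_dist: "Metric_space X seq_dist"
proof
  fix x y z :: "int \<Rightarrow> nat"
  show "0 \<le> seq_dist x y" by (rule seq_dist_nonneg)
  show "seq_dist x y = seq_dist y x" unfolding seq_dist_def by (simp add: eq_commute)
  show "seq_dist x y = 0 \<longleftrightarrow> x = y"
  proof
    assume 0: "seq_dist x y = 0"
    show "x = y"
    proof
      fix n show "x n = y n"
        using seq_dist_less_imp_eq[of x y "nat \<bar>n\<bar>" n] 0 by simp
    qed
  next
    assume "x = y"
    then have le: "seq_dist x y \<le> 1 / 2 ^ m" for m by (intro seq_dist_le) simp
    show "seq_dist x y = 0"
    proof (rule ccontr)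
      assume "seq_dist x y \<noteq> 0"
      then have "0 < seq_dist x y" using seq_dist_nonneg[of x y] by simp
      then obtain m where "1 / 2 ^ m < seq_dist x y" by (rule pow_half_small)
      then show False using le[of m] by simp
    qed
  qed
  show "seq_dist x z \<le> seq_dist x y + seq_dist y z"
  proof (rule field_le_epsilon)
    fix e :: real assume e: "0 < e"
    obtain m1 where m1: "1 / 2 ^ m1 < seq_dist x y + e / 2" "\<And>n. \<bar>n\<bar> < int m1 \<Longrightarrow> x n = y n"
      using seq_dist_witness[of x y "seq_dist x y + e / 2"] e by auto
    obtain m2 where m2: "1 / 2 ^ m2 < seq_dist y z + e / 2" "\<And>n. \<bar>n\<bar> < int m2 \<Longrightarrow> y n = z n"
      using seq_dist_witness[of y z "seq_dist y z + e / 2"] e by auto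
    have "seq_dist x z \<le> 1 / 2 ^ (min m1 m2)"
      using m1(2) m2(2) by (intro seq_dist_le) auto
    also have "\<dots> \<le> 1 / 2 ^ m1 + 1 / 2 ^ m2" by (simp add: min_def)
    finally show "seq_dist x z \<le> seq_dist x y + seq_dist y z + e" using m1(1) m2(1) by linarith
  qed
qed

text \<open>Serves to extend a base arc to a bi-infinite billiard sequence, with \<open>f\<close>
  the bounce and \<open>g\<close> its inverse.\<close>

lemma funpow_int_shift:
  fixes n :: int
  assumes inv: "\<And>x. P x \<Longrightarrow> f (g x) = x" "\<And>x. P x \<Longrightarrow> P (f x)" "\<And>x. P x \<Longrightarrow> P (g x)" and x: "P x"
  defines "s \<equiv> \<lambda>n. if 0 \<le> n then (f ^^ nat n) x else (g ^^ nat (- n)) x"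
  shows "P (s n)" "s (n + 1) = f (s n)"
proof -
  have P: "P ((f ^^ m) x)" "P ((g ^^ m) x)" for m
    using assms(2,3) x by (induction m) auto
  then show "P (s n)" by (simp add: s_def)
  consider "n \<ge> 0" | m where "n = - int (Suc m)"
    by (metis not_le int_cases2 nonneg_int_cases negD)
  then show "s (n + 1) = f (s n)"
  proof cases
    case 1
    then show ?thesis by (simp add: s_def nat_add_distrib)
  next
    case 2
    then have "s n = g ((g ^^ m) x)" "s (n + 1) = (g ^^ m) x"
      by (auto simp: s_def nat_add_distrib)
    then show ?thesis using inv(1)[OF P(2)] by simp
  qed
qed

context ideal_polygon
begin

text \<open>The natural extension of \<open>bd_map\<close>: the end loses its first label, and the
  start receives this label in front of its code. \<open>bwd\<close> is the same map with start and
  end exchanged.\<close>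

definition fwd :: "dirgeo \<Rightarrow> dirgeo" where
  "fwd e = (side_refl (lab (snd e)) (fst e), bd_map (snd e))"

definition bwd :: "dirgeo \<Rightarrow> dirgeo" where
  "bwd e = (bd_map (fst e), side_refl (lab (fst e)) (snd e))"

text \<open>These turn out to be exactly the base arcs of billiard trajectories. Different labels
  mean that the chord crosses the polygon.\<close>

definition base_arc :: "dirgeo \<Rightarrow> bool" where
  "base_arc e \<longleftrightarrow> regular (fst e) \<and> regular (snd e) \<and> lab (fst e) \<noteq> lab (snd e)"

lemma base_arc_fwd:
  assumes "base_arc e"
  shows "base_arc (fwd e)" "bwd (fwd e) = e" "lab (fst (fwd e)) = lab (snd e)"
proof -
  have r: "regular (fst e)" "regular (snd e)" "lab (fst e) \<noteq> lab (snd e)"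
    using assms by (auto simp: base_arc_def)
  show "base_arc (fwd e)" "bwd (fwd e) = e" "lab (fst (fwd e)) = lab (snd e)"
    using regular_side_refl[OF r(1) regular_lab(1)[OF r(2)] r(3)] regular_bd_map[OF r(2)]
    by (auto simp: base_arc_def fwd_def bwd_def)
qed

lemma base_arc_bwd:
  assumes "base_arc e"
  shows "base_arc (bwd e)" "fwd (bwd e) = e"
proof -
  have r: "regular (snd e)" "regular (fst e)" "lab (snd e) \<noteq> lab (fst e)"
    using assms by (auto simp: base_arc_def)
  show "base_arc (bwd e)" "fwd (bwd e) = e"
    using regular_side_refl[OF r(1) regular_lab(1)[OF r(2)] r(3)] regular_bd_map[OF r(2)]
    by (auto simp: base_arc_def fwd_def bwd_def)
qed

lemma base_arc_nonvertex:
  assumes "base_arc e"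
  shows "fst e \<notin> verts" "snd e \<notin> verts"
  using assms unfolding base_arc_def regular_def by (metis funpow_0)+

lemma bounce_fwd:
  assumes "base_arc e"
  shows "bounce k v e (fwd e)"
proof -
  have r: "regular (fst e)" "regular (snd e)" "lab (fst e) \<noteq> lab (snd e)"
    using assms by (auto simp: base_arc_def)
  have "0 < side_fun (lab (snd e)) (fst e)"
    using arc_side_fun_pos[OF regular_lab(2,1)[OF r(1)] regular_lab(1)[OF r(2)] r(3)] .
  from bounceI[OF regular_lab[OF r(2)] regular_norm[OF r(1)] this]
  show ?thesis by (simp add: fwd_def bd_map_def)
qed

text \<open>The last claim lets the past be read off the starting points before these are known to
  be regular.\<close>

lemma bounce_eq_fwd:
  assumes "bounce k v e e'" "fst e \<notin> verts" "snd e \<notin> verts"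
  shows "e' = fwd e" "cmod (fst e) = 1" "cmod (snd e) = 1" "lab (fst e) \<noteq> lab (snd e)"
    "bd_map (fst e') = fst e"
proof -
  obtain j where j: "j \<in> labels" "snd e \<in> arc j" "cmod (fst e) = 1" "0 < side_fun j (fst e)"
    and e': "e' = (side_refl j (fst e), side_refl j (snd e))"
    using bounceD[OF assms] .
  have lab: "lab (snd e) = j" by (rule lab_eq[OF j(2,1)])
  show "e' = fwd e" by (simp add: e' fwd_def bd_map_def lab)
  show "cmod (fst e) = 1" "cmod (snd e) = 1" using j by (auto simp: arc_def)
  show "lab (fst e) \<noteq> lab (snd e)"
    using lab_props[OF j(3) assms(2)] j(4) by (auto simp: lab arc_def)
  have "side_refl j (fst e) \<in> arc j"
    using side_fun_side_refl(1)[OF j(1,3)] norm_side_refl[OF j(1,3)] j(4) by (simp add: arc_def)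
  then have "lab (fst e') = j" using lab_eq j(1) by (simp add: e')
  then show "bd_map (fst e') = fst e"
    unfolding bd_map_def by (simp add: e' side_refl_side_refl[OF j(1,3)])
qed

lemma bounce_map_eq: "base_arc e \<Longrightarrow> bounce_map k v e = fwd e"
  unfolding bounce_map_def
  using bounce_fwd bounce_eq_fwd(1) base_arc_nonvertex by (intro the_equality) blast+

text \<open>The ends of the later arcs are the orbit of the end under \<open>bd_map\<close>, and the
  starts of the earlier arcs are the orbit of the start. None of these points is a vertex, which is
  regularity.\<close>

lemma billiard_seqD:
  assumes "billiard_seq k v g"
  shows "base_arc (g n)" "g (n + 1) = fwd (g n)"
proof -
  have b: "bounce k v (g n) (g (n + 1))" "fst (g n) \<notin> verts" "snd (g n) \<notin> verts" for n
    using assms by (auto simp: billiard_seq_def)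
  note f = bounce_eq_fwd[OF b]
  show "g (n + 1) = fwd (g n)" by (rule f(1))
  have "(bd_map ^^ m) (snd (g n)) = snd (g (n + int m))" for m n
  proof (induction m)
    case (Suc m)
    have "snd (g (n + int m + 1)) = bd_map (snd (g (n + int m)))"
      using f(1)[of "n + int m"] by (simp add: fwd_def)
    then show ?case using Suc.IH by (simp add: add_ac)
  qed simp
  then have 1: "regular (snd (g n))" using b f(3) by (simp add: regular_def)
  have "(bd_map ^^ m) (fst (g n)) = fst (g (n - int m))" for m n
  proof (induction m)
    case (Suc m)
    have "bd_map (fst (g (n - int (Suc m) + 1))) = fst (g (n - int (Suc m)))" by (rule f(5))
    then show ?case using Suc.IH by simp
  qed simp
  then have 2: "regular (fst (g n))" using b f(2) by (simp add: regular_def)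
  show "base_arc (g n)" using 1 2 f(4) by (simp add: base_arc_def)
qed

lemma billiard_seqI:
  assumes "\<And>n. base_arc (g n)" "\<And>n. g (n + 1) = fwd (g n)"
  shows "billiard_seq k v g"
  unfolding billiard_seq_def using bounce_fwd base_arc_nonvertex assms by auto

lemma billiard_seq_exists:
  assumes "base_arc e"
  obtains g where "billiard_seq k v g" "g 0 = e"
proof -
  define g where "g = (\<lambda>n::int. if 0 \<le> n then (fwd ^^ nat n) e else (bwd ^^ nat (- n)) e)"
  have "billiard_seq k v g"
    using funpow_int_shift[of base_arc fwd bwd e] base_arc_fwd(1) base_arc_bwd assms
    by (intro billiard_seqI) (auto simp: g_def)
  then show ?thesis using that by (simp add: g_def)
qed

lemma billiard_seq_unique:
  assumes g: "billiard_seq k v g" and g': "billiard_seq k v g'" and 0: "g 0 = g' 0"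
  shows "g = g'"
proof
  have b: "g n = bwd (g (n + 1))" "g' n = bwd (g' (n + 1))" for n
    using billiard_seqD[OF g] billiard_seqD[OF g'] base_arc_fwd(2) by auto
  fix n show "g n = g' n"
  proof (induction n rule: int_induct[where k = 0])
    case (step1 i)
    then show ?case using billiard_seqD(2)[OF g] billiard_seqD(2)[OF g'] by simp
  next
    case (step2 i)
    then show ?case using b[of "i - 1"] by simp
  qed (rule 0)
qed

text \<open>Label \<open>n\<close> is the side where base arc \<open>n\<close> ends, so the starting point of base arc \<open>0\<close> lies behind
  side number \<open>-1\<close>.\<close>

definition itinerary :: "trajectory \<times> dirgeo \<Rightarrow> int \<Rightarrow> nat" where
  "itinerary p n = (if 0 \<le> n then code (snd (snd p)) (nat n) else code (fst (snd p)) (nat (- n - 1)))"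

section \<open>Pointed geodesics and their itineraries\<close>

lemma pointed_geodesicsE:
  assumes "p \<in> pointed_geodesics k v"
  obtains g where "billiard_seq k v g" "p = (trajectory_of g, g 0)"
  using assms by (auto simp: pointed_geodesics_def)

lemma pointed_geodesics_base_arc: "p \<in> pointed_geodesics k v \<Longrightarrow> base_arc (snd p)"
  using pointed_geodesicsE billiard_seqD(1) by (metis snd_conv)

lemma pointed_geodesics_regular:
  assumes "p \<in> pointed_geodesics k v"
  shows "regular (fst (snd p))" "regular (snd (snd p))"
  using pointed_geodesics_base_arc[OF assms] by (auto simp only: base_arc_def)

lemma pointed_geodesics_eqI:
  assumes "p \<in> pointed_geodesics k v" "q \<in> pointed_geodesics k v" "snd p = snd q"
  shows "p = q"
proof -
  obtain g g' where "billiard_seq k v g" "p = (trajectory_of g, g 0)"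
    "billiard_seq k v g'" "q = (trajectory_of g', g' 0)"
    using pointed_geodesicsE assms(1,2) by metis
  then show ?thesis using billiard_seq_unique[of g g'] assms(3) by simp
qed

lemma trajectory_of_shift: "trajectory_of (\<lambda>n. g (n + m)) = trajectory_of g"
proof -
  have "range (\<lambda>l n. g (n + l + m)) = range (\<lambda>l n. g (n + l))"
  proof (intro set_eqI iffI)
    fix f assume "f \<in> range (\<lambda>l n. g (n + l + m))"
    then obtain l where "f = (\<lambda>n. g (n + (l + m)))" by (auto simp: add.assoc)
    then show "f \<in> range (\<lambda>l n. g (n + l))" by blast
  next
    fix f assume "f \<in> range (\<lambda>l n. g (n + l))"
    then obtain l where "f = (\<lambda>n. g (n + (l - m) + m))" by auto
    then show "f \<in> range (\<lambda>l n. g (n + l + m))" by blast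
  qed
  then show ?thesis unfolding trajectory_of_def .
qed

lemma tau_pointed:
  assumes "billiard_seq k v g"
  shows "tau k v (trajectory_of g, g 0) = (trajectory_of (\<lambda>n. g (n + 1)), g 1)"
    "billiard_seq k v (\<lambda>n. g (n + 1))"
proof -
  show "tau k v (trajectory_of g, g 0) = (trajectory_of (\<lambda>n. g (n + 1)), g 1)"
    using bounce_map_eq[OF billiard_seqD(1)[OF assms]] billiard_seqD(2)[OF assms, of 0]
    by (simp add: tau_def trajectory_of_shift)
  show "billiard_seq k v (\<lambda>n. g (n + 1))"
    using assms unfolding billiard_seq_def by blast
qed

lemma tau_in: "p \<in> pointed_geodesics k v \<Longrightarrow> tau k v p \<in> pointed_geodesics k v"
proof (erule pointed_geodesicsE)
  fix g assume g: "billiard_seq k v g" "p = (trajectory_of g, g 0)"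
  show ?thesis
    using tau_pointed[OF g(1)] by (auto simp: pointed_geodesics_def g(2) intro!: exI[of _ "\<lambda>n. g (n + 1)"])
qed

text \<open>After a bounce the start lies behind the side just hit: the start of arc
  \<open>n + 1\<close> has the label of the end of arc \<open>n\<close>. This joins the two halves
  of \<open>itinerary\<close> at index 0.\<close>

lemma itinerary_billiard:
  assumes g: "billiard_seq k v g"
  shows "itinerary (\<gamma>, g 0) n = lab (snd (g n))"
proof -
  have s: "(bd_map ^^ m) (snd (g 0)) = snd (g (int m))" for m
  proof (induction m)
    case (Suc m)
    then show ?case using billiard_seqD(2)[OF g, of "int m"] by (simp add: fwd_def add.commute)
  qed simp
  have f: "(bd_map ^^ m) (fst (g 0)) = fst (g (- int m))" for m
  proof (induction m)
    case (Suc m)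
    have "bwd (g (- int m)) = g (- int (Suc m))"
      using billiard_seqD(2)[OF g, of "- int (Suc m)"] base_arc_fwd(2)[OF billiard_seqD(1)[OF g, of "- int (Suc m)"]]
      by simp
    then have "bd_map (fst (g (- int m))) = fst (g (- int (Suc m)))" by (metis bwd_def fst_conv)
    then show ?case using Suc.IH by simp
  qed simp
  show ?thesis
  proof (cases "0 \<le> n")
    case True
    then show ?thesis by (simp add: itinerary_def code_def s)
  next
    case False
    then have "itinerary (\<gamma>, g 0) n = lab (fst (g (n + 1)))"
      by (simp add: itinerary_def code_def f add.commute)
    also have "\<dots> = lab (snd (g n))"
      unfolding billiard_seqD(2)[OF g] by (rule base_arc_fwd(3)[OF billiard_seqD(1)[OF g]])
    finally show ?thesis .
  qed
qed

lemma itinerary_tau: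
  assumes "p \<in> pointed_geodesics k v"
  shows "itinerary (tau k v p) = shift (itinerary p)"
proof -
  obtain g where g: "billiard_seq k v g" "p = (trajectory_of g, g 0)"
    using assms by (rule pointed_geodesicsE)
  show ?thesis
    using itinerary_billiard[OF tau_pointed(2)[OF g(1)]] itinerary_billiard[OF g(1)] tau_pointed(1)[OF g(1)]
    by (auto simp: g(2) shift_def fun_eq_iff)
qed

lemma adjacent_commute: "adjacent k a b \<longleftrightarrow> adjacent k b a"
  by (auto simp: adjacent_def)

lemma itinerary_in:
  assumes "p \<in> pointed_geodesics k v"
  shows "itinerary p \<in> coding_space k"
proof -
  obtain g where g: "billiard_seq k v g" "p = (trajectory_of g, g 0)"
    using assms by (rule pointed_geodesicsE)
  have it: "itinerary p n = lab (snd (g n))" for n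
    unfolding g(2) by (rule itinerary_billiard[OF g(1)])
  have r: "regular (fst (g n))" "regular (snd (g n))" for n
    using billiard_seqD(1)[OF g(1)] by (auto simp: base_arc_def)
  have lab: "itinerary p n \<in> labels" for n
    unfolding it using regular_lab(1)[OF r(2)] .
  have ne: "itinerary p n \<noteq> itinerary p (n + 1)" for n
    unfolding it billiard_seqD(2)[OF g(1)]
    using regular_bd_map(2)[OF r(2), of n] by (simp add: fwd_def)
  have right: "\<not> alternates_on {N..} a b (itinerary p)"
    if ab: "a \<in> labels" "b \<in> labels" "adjacent k a b" for a b N
  proof
    assume alt: "alternates_on {N..} a b (itinerary p)"
    obtain n where n: "n \<ge> nat N" "code (snd (g 0)) n \<noteq> (if even n then a else b)"
      using admissible_code[OF r(2)[of 0]] ab unfolding admissible_def by blast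
    have "itinerary p (int n) = code (snd (g 0)) n" by (simp add: itinerary_def g(2))
    moreover have "int n \<in> {N..}" using n(1) by auto
    ultimately show False using alt n(2) by (auto simp: alternates_on_def)
  qed
  have left: "\<not> alternates_on {..N} a b (itinerary p)"
    if ab: "a \<in> labels" "b \<in> labels" "adjacent k a b" for a b N
  proof
    assume alt: "alternates_on {..N} a b (itinerary p)"
    \<comment> \<open>Entry \<open>n\<close> of the past has index \<open>- n - 1\<close>, of
      opposite parity, so \<open>a\<close> and \<open>b\<close> change places.\<close>
    obtain n where n: "n \<ge> nat (- N)" "code (fst (g 0)) n \<noteq> (if even n then b else a)"
      using admissible_code[OF r(1)[of 0]] ab adjacent_commute unfolding admissible_def by blast
    have "itinerary p (- int n - 1) = code (fst (g 0)) n" by (simp add: itinerary_def g(2))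
    moreover have "- int n - 1 \<in> {..N}" using n(1) by auto
    ultimately have "code (fst (g 0)) n = (if even (- int n - 1) then a else b)"
      using alt unfolding alternates_on_def by metis
    then show False using n(2) by (simp split: if_splits)
  qed
  have "\<not> alternates_on UNIV a b (itinerary p)"
    if ab: "a \<in> labels" "b \<in> labels" "adjacent k a b" for a b
    using right[OF ab, of 0] unfolding alternates_on_def by blast
  then show ?thesis
    unfolding coding_space_def using lab ne right left by blast
qed

lemma itinerary_inj: "inj_on itinerary (pointed_geodesics k v)"
proof (rule inj_onI)
  fix p q assume p: "p \<in> pointed_geodesics k v" and q: "q \<in> pointed_geodesics k v"
    and eq: "itinerary p = itinerary q"
  have r: "regular (fst (snd p))" "regular (snd (snd p))" "regular (fst (snd q))" "regular (snd (snd q))"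
    using pointed_geodesics_regular p q by blast+
  have "code (snd (snd p)) n = code (snd (snd q)) n" for n
    using fun_cong[OF eq, of "int n"] by (simp add: itinerary_def)
  then have 1: "snd (snd p) = snd (snd q)" by (intro code_inj r ext)
  have "code (fst (snd p)) n = code (fst (snd q)) n" for n
    using fun_cong[OF eq, of "- int n - 1"] by (simp add: itinerary_def)
  then have "fst (snd p) = fst (snd q)" by (intro code_inj r ext)
  then show "p = q" using 1 by (intro pointed_geodesics_eqI p q prod_eqI)
qed

text \<open>The sequence is cut at the dot. Each half is the code of one boundary point, and rule
  (1) across the cut makes the two points the ends of a base arc.\<close>

lemma itinerary_surj:
  assumes x: "x \<in> coding_space k"
  shows "x \<in> itinerary ` pointed_geodesics k v"
proof -
  have xl: "x n \<in> labels" "x n \<noteq> x (n + 1)" for n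
    using x by (auto simp: coding_space_def)
  define y where "y = (\<lambda>n::nat. x (int n))"
  define y' where "y' = (\<lambda>n::nat. x (- int n - 1))"
  have "\<exists>n\<ge>N. y n \<noteq> (if even n then a else b)"
    if ab: "a \<in> labels" "b \<in> labels" "adjacent k a b" for a b N
  proof (rule ccontr)
    assume *: "\<not> ?thesis"
    have "alternates_on {int N..} a b x"
      unfolding alternates_on_def
    proof
      fix i assume "i \<in> {int N..}"
      then obtain n where "i = int n" "n \<ge> N" by (auto dest: zero_le_imp_eq_int[OF order_trans[OF of_nat_0_le_iff]])
      then show "x i = (if even i then a else b)" using * by (auto simp: y_def)
    qed
    then show False using x ab by (auto simp: coding_space_def)
  qed
  moreover have "label_seq y"
    using xl(1) xl(2)[of "int n" for n] by (auto simp: label_seq_def y_def add.commute)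
  ultimately have 1: "admissible y" unfolding admissible_def by blast
  have "\<exists>n\<ge>N. y' n \<noteq> (if even n then a else b)"
    if ab: "a \<in> labels" "b \<in> labels" "adjacent k a b" for a b N
  proof (rule ccontr)
    assume *: "\<not> ?thesis"
    have "alternates_on {..- int N - 1} b a x"
      unfolding alternates_on_def
    proof
      fix i assume "i \<in> {..- int N - 1}"
      then have "i = - int (nat (- i - 1)) - 1" "nat (- i - 1) \<ge> N" by auto
      then obtain n where "i = - int n - 1" "n \<ge> N" by blast
      then show "x i = (if even i then b else a)" using * by (auto simp: y'_def)
    qed
    then show False using x ab adjacent_commute by (auto simp: coding_space_def)
  qed
  moreover have "label_seq y'"
    unfolding label_seq_def
  proof
    fix n
    have "- int (Suc n) - 1 + 1 = - int n - 1" by simp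
    then have "y' n \<noteq> y' (Suc n)"
      using xl(2)[of "- int (Suc n) - 1"] unfolding y'_def by metis
    then show "y' n \<in> labels \<and> y' n \<noteq> y' (Suc n)" using xl(1) by (simp add: y'_def)
  qed
  ultimately have 2: "admissible y'" unfolding admissible_def by blast
  obtain \<phi> where phi: "regular \<phi>" "code \<phi> = y" using code_surj[OF 1] .
  obtain \<theta> where theta: "regular \<theta>" "code \<theta> = y'" using code_surj[OF 2] .
  have "lab \<phi> = x 0" "lab \<theta> = x (- 1)"
    using fun_cong[OF phi(2), of 0] fun_cong[OF theta(2), of 0] by (auto simp: code_def y_def y'_def)
  then have "base_arc (\<theta>, \<phi>)" using phi theta xl(2)[of "- 1"] by (simp add: base_arc_def)
  then obtain g where g: "billiard_seq k v g" "g 0 = (\<theta>, \<phi>)" by (rule billiard_seq_exists)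
  have "itinerary (trajectory_of g, g 0) = x"
    by (rule ext) (simp add: itinerary_def g(2) phi theta y_def y'_def)
  then show ?thesis using g(1) unfolding pointed_geodesics_def by blast
qed

section \<open>The metric on pointed geodesics and the continuity of the coding\<close>

lemma geo_dist_less_iff:
  "geo_dist p q < c \<longleftrightarrow> bd_dist (fst (snd p)) (fst (snd q)) < c \<and> bd_dist (snd (snd p)) (snd (snd q)) < c"
  by (cases p; cases q) (auto simp: geo_dist_def)

lemma Metric_space_geo_dist: "Metric_space (pointed_geodesics k v) geo_dist"
proof
  fix p q :: "trajectory \<times> dirgeo"
  show "0 \<le> geo_dist p q"
    by (cases p; cases q) (auto simp: geo_dist_def le_max_iff_disj bd_dist_nonneg)
  show "geo_dist p q = geo_dist q p"
    by (cases p; cases q) (auto simp: geo_dist_def bd_dist_commute)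
next
  fix p q assume p: "p \<in> pointed_geodesics k v" and q: "q \<in> pointed_geodesics k v"
  have n: "cmod (fst (snd p)) = 1" "cmod (snd (snd p)) = 1" "cmod (fst (snd q)) = 1" "cmod (snd (snd q)) = 1"
    using pointed_geodesics_regular p q regular_norm by blast+
  show "geo_dist p q = 0 \<longleftrightarrow> p = q"
  proof
    assume "geo_dist p q = 0"
    then have "bd_dist (fst (snd p)) (fst (snd q)) \<le> 0" "bd_dist (snd (snd p)) (snd (snd q)) \<le> 0"
      by (cases p; cases q; auto simp: geo_dist_def max_def split: if_splits)+
    then have "cmod (fst (snd p) - fst (snd q)) \<le> 0" "cmod (snd (snd p) - snd (snd q)) \<le> 0"
      using norm_diff_le_bd_dist[OF n(1,3)] norm_diff_le_bd_dist[OF n(2,4)] by linarith+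
    then have "fst (snd p) = fst (snd q)" "snd (snd p) = snd (snd q)" by simp_all
    then show "p = q" by (intro pointed_geodesics_eqI p q prod_eqI)
  next
    assume "p = q"
    then show "geo_dist p q = 0"
      using n by (cases q) (auto simp: geo_dist_def bd_dist_self unit_nonzero)
  qed
next
  fix p q r assume p: "p \<in> pointed_geodesics k v" and q: "q \<in> pointed_geodesics k v"
    and r: "r \<in> pointed_geodesics k v"
  have n: "cmod (fst (snd p)) = 1" "cmod (snd (snd p)) = 1" "cmod (fst (snd q)) = 1" "cmod (snd (snd q)) = 1"
     "cmod (fst (snd r)) = 1" "cmod (snd (snd r)) = 1"
    using pointed_geodesics_regular p q r regular_norm by blast+
  show "geo_dist p r \<le> geo_dist p q + geo_dist q r"
    using bd_dist_triangle[OF n(1,3,5)] bd_dist_triangle[OF n(2,4,6)]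
    by (cases p; cases q; cases r) (auto simp: geo_dist_def)
qed

lemma itinerary_continuous:
  assumes p: "p \<in> pointed_geodesics k v" and e: "0 < \<epsilon>"
  shows "\<exists>\<delta>>0. \<forall>q\<in>pointed_geodesics k v. geo_dist p q < \<delta> \<longrightarrow> seq_dist (itinerary p) (itinerary q) < \<epsilon>"
proof -
  obtain m where m: "1 / 2 ^ m < \<epsilon>" using pow_half_small[OF e] .
  have r: "regular (fst (snd p))" "regular (snd (snd p))"
    using pointed_geodesics_regular[OF p] by blast+
  obtain \<delta>1 where d1: "\<delta>1 > 0" "\<And>w. regular w \<Longrightarrow> cmod (fst (snd p) - w) < \<delta>1 \<Longrightarrow> \<forall>n<m. code w n = code (fst (snd p)) n"
    using code_locally_constant[OF r(1), of m] by auto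
  obtain \<delta>2 where d2: "\<delta>2 > 0" "\<And>w. regular w \<Longrightarrow> cmod (snd (snd p) - w) < \<delta>2 \<Longrightarrow> \<forall>n<m. code w n = code (snd (snd p)) n"
    using code_locally_constant[OF r(2), of m] by auto
  show ?thesis
  proof (intro exI[of _ "min \<delta>1 \<delta>2"] conjI ballI impI)
    show "0 < min \<delta>1 \<delta>2" using d1 d2 by simp
    fix q assume q: "q \<in> pointed_geodesics k v" and d: "geo_dist p q < min \<delta>1 \<delta>2"
    have s: "regular (fst (snd q))" "regular (snd (snd q))"
      using pointed_geodesics_regular[OF q] by blast+
    have "cmod (fst (snd p) - fst (snd q)) < \<delta>1" "cmod (snd (snd p) - snd (snd q)) < \<delta>2"
      using d norm_diff_le_bd_dist[OF regular_norm[OF r(1)] regular_norm[OF s(1)]]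
        norm_diff_le_bd_dist[OF regular_norm[OF r(2)] regular_norm[OF s(2)]]
      by (auto simp: geo_dist_less_iff)
    then have "\<forall>n<m. code (fst (snd q)) n = code (fst (snd p)) n" "\<forall>n<m. code (snd (snd q)) n = code (snd (snd p)) n"
      using d1(2)[OF s(1)] d2(2)[OF s(2)] by auto
    then have "seq_dist (itinerary p) (itinerary q) \<le> 1 / 2 ^ m"
      by (intro seq_dist_le) (auto simp: itinerary_def)
    then show "seq_dist (itinerary p) (itinerary q) < \<epsilon>" using m by linarith
  qed
qed

lemma itinerary_inverse_continuous:
  assumes e: "0 < \<epsilon>"
  shows "\<exists>\<delta>>0. \<forall>p\<in>pointed_geodesics k v. \<forall>q\<in>pointed_geodesics k v.
    seq_dist (itinerary p) (itinerary q) < \<delta> \<longrightarrow> geo_dist p q < \<epsilon>"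
proof -
  obtain \<delta> where d: "0 < \<delta>" "\<And>z w. cmod z = 1 \<Longrightarrow> cmod w = 1 \<Longrightarrow> cmod (z - w) < \<delta> \<Longrightarrow> bd_dist z w < \<epsilon>"
    using bd_dist_small[OF e] by blast
  obtain N where N: "\<forall>z w. regular z \<longrightarrow> regular w \<longrightarrow> (\<forall>n\<le>N. code z n = code w n) \<longrightarrow> cmod (z - w) < \<delta>"
    using code_determines[OF d(1)] by blast
  show ?thesis
  \<comment> \<open>Entry \<open>N\<close> of the past sits at index \<open>- N - 1\<close>, one
    place further out than entry \<open>N\<close> of the future.\<close>
  proof (intro exI[of _ "1 / 2 ^ Suc N"] conjI ballI impI)
    fix p q assume p: "p \<in> pointed_geodesics k v" and q: "q \<in> pointed_geodesics k v"
      and s: "seq_dist (itinerary p) (itinerary q) < 1 / 2 ^ Suc N"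
    have r: "regular (fst (snd p))" "regular (snd (snd p))" "regular (fst (snd q))" "regular (snd (snd q))"
      using pointed_geodesics_regular p q by blast+
    have eq: "itinerary p n = itinerary q n" if "\<bar>n\<bar> \<le> int (Suc N)" for n
      by (rule seq_dist_less_imp_eq[OF s that])
    have "code (snd (snd p)) n = code (snd (snd q)) n" if "n \<le> N" for n
      using eq[of "int n"] that by (simp add: itinerary_def)
    moreover have "code (fst (snd p)) n = code (fst (snd q)) n" if "n \<le> N" for n
      using eq[of "- int n - 1"] that by (simp add: itinerary_def)
    ultimately show "geo_dist p q < \<epsilon>"
      unfolding geo_dist_less_iff using N r d(2) regular_norm by blast
  qed simp
qed

lemma itinerary_homeomorphic_map:
  "homeomorphic_map (Metric_space.mtopology (pointed_geodesics k v) geo_dist)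
     (Metric_space.mtopology (coding_space k) seq_dist) itinerary"
proof -
  let ?M = "pointed_geodesics k v" and ?X = "coding_space k"
  interpret G: Metric_space ?M geo_dist by (rule Metric_space_geo_dist)
  interpret S: Metric_space ?X seq_dist by (rule Metric_space_seq_dist)
  define h where "h = inv_into ?M itinerary"
  have bij: "bij_betw itinerary ?M ?X"
    using itinerary_inj itinerary_in itinerary_surj by (auto simp: bij_betw_def)
  have hi: "h (itinerary p) = p" if "p \<in> ?M" for p
    unfolding h_def using that itinerary_inj by simp
  have h: "h x \<in> ?M" "itinerary (h x) = x" if "x \<in> ?X" for x
    unfolding h_def using itinerary_surj[OF that] by (auto intro: inv_into_into f_inv_into_f)
  have "continuous_map G.mtopology S.mtopology itinerary"
    unfolding G.metric_continuous_map[OF Metric_space_seq_dist]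
    using itinerary_in itinerary_continuous unfolding image_subset_iff by blast
  moreover have "continuous_map S.mtopology G.mtopology h"
    unfolding S.metric_continuous_map[OF Metric_space_geo_dist]
  proof (intro conjI ballI allI impI)
    show "h ` ?X \<subseteq> ?M" using h by auto
    fix x \<epsilon> assume x: "x \<in> ?X" and e: "(0::real) < \<epsilon>"
    obtain \<delta> where d: "\<delta> > 0" "\<forall>p\<in>?M. \<forall>q\<in>?M. seq_dist (itinerary p) (itinerary q) < \<delta> \<longrightarrow> geo_dist p q < \<epsilon>"
      using itinerary_inverse_continuous[OF e] by blast
    show "\<exists>\<delta>>0. \<forall>y. y \<in> ?X \<and> seq_dist x y < \<delta> \<longrightarrow> geo_dist (h x) (h y) < \<epsilon>"
      using d h x by (intro exI[of _ \<delta>]) auto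
  qed
  ultimately have "homeomorphic_maps G.mtopology S.mtopology itinerary h"
    unfolding homeomorphic_maps_def using hi h by auto
  then show ?thesis by (rule homeomorphic_maps_imp_map)
qed

end

theorem theorem3p2:
  fixes k :: nat and v :: "nat \<Rightarrow> complex"
  assumes "ideal_polygon_vertices k v"
  shows "conjugate_systems
           (pointed_geodesics k v) geo_dist (tau k v)
           (coding_space k) seq_dist shift"
proof -
  interpret ideal_polygon k v by unfold_locales (rule assms)
  \<comment> \<open>Invariance of the coding space is transported from \<open>tau\<close>, which
    avoids tracking the parity in rule (2) under the shift.\<close>
  have "shift x \<in> coding_space k" if "x \<in> coding_space k" for x
  proof -
    obtain p where p: "p \<in> pointed_geodesics k v" "x = itinerary p" using itinerary_surj[OF \<open>x \<in> coding_space k\<close>] by (rule imageE)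
    show ?thesis using itinerary_in[OF tau_in[OF p(1)]] itinerary_tau[OF p(1)] p(2) by simp
  qed
  then show ?thesis
    unfolding conjugate_systems_def
    using Metric_space_geo_dist Metric_space_seq_dist tau_in itinerary_homeomorphic_map itinerary_tau
    by blast
qed

end
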